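(* Let $N,d\ge 1$ be integers and let $A,B\in\mathfrak{M}_d$. Let $X:[0,1]\to\mathfrak{M}_d$ be a path and, for each $t$, let $X(t)=U(t)\Sigma(t)V(t)^T$ be a singular value decomposition ($U(t),V(t)\in O_d$, $\Sigma(t)$ diagonal with positive diagonal entries). Then $X$ is a geodesic between $A$ and $B$ on the Riemannian manifold $(\mathfrak{M}_d,g^N)$ if and only if there is a path $P:[0,1]\to\mathbb{M}_d$ such that $(X,P)$ satisfies the Dirichlet boundary value problem $$ \begin{cases} \dot X=\mathcal{A}_{N,X}(P),\\[2pt] \dot P=-U\left(\displaystyle\sum_{p=1}^N\left\{\left[f^{[1]}_{\frac{N-p}{N}}(\Sigma^2)\circ M_1\right]\Sigma+\Sigma\left[f^{[1]}_{\frac{p-1}{N}}(\Sigma^2)\circ M_2\right]\right\}\right)V^T,\\[2pt] X(0)=A,\\ X(1)=B, \end{cases} $$ where, for each $p$, $M_1$ and $M_2$ are the symmetric matrices $$M_1=(U^TPV)\,\Sigma^{\frac{2(p-1)}{N}}\,(U^TPV)^T,\qquad M_2=(U^TPV)^T\,\Sigma^{\frac{2(N-p)}{N}}\,(U^TPV).$$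
   Context: $\mathbb{M}_d$, $\mathfrak{M}_d$, $O_d$ denote the sets of all, invertible, and orthogonal real $d\times d$ matrices, respectively. Tangent and cotangent spaces of $\mathfrak{M}_d$ are identified with $\mathbb{M}_d$ via the Frobenius pairing $\langle P,Z\rangle=\operatorname{Tr}(P^TZ)$. For $X\in\mathfrak{M}_d$, $\mathcal{A}_{N,X}:\mathbb{M}_d\to\mathbb{M}_d$ is the linear operator $$\mathcal{A}_{N,X}(Z)=\sum_{p=1}^N (XX^T)^{\frac{N-p}{N}}\,Z\,(X^TX)^{\frac{p-1}{N}},$$ and $g^N$ is the Riemannian metric on $\mathfrak{M}_d$ given by $\|Z\|^2_{g^N}=\operatorname{Tr}\left(Z^T\mathcal{A}_{N,X}^{-1}(Z)\right)$ for $Z\in T_X\mathfrak{M}_d$. A geodesic between two points $A,B$ of a Riemannian manifold $(\mathcal{X},g)$ is an extremal (critical point) of the action $\int_0^1 g_{x(t)}(\dot x(t),\dot x(t))\,dt$ over $C^1$ paths $x:[0,1]\to\mathcal{X}$ with $x(0)=A$, $x(1)=B$. (Geodesics are not required to be length minimizing.) For $\alpha\in\mathbb{R}$ and a diagonal matrix $\Lambda=\operatorname{diag}(\lambda_1,\dots,\lambda_d)$ with positive entries, $f^{[1]}_\alpha(\Lambda)$ is the $d\times d$ matrix with entries $\frac{\lambda_i^\alpha-\lambda_j^\alpha}{\lambda_i-\lambda_j}$ if $\lambda_i\ne\lambda_j$, and $\alpha\lambda_i^{\alpha-1}$ if $\lambda_i=\lambda_j$ (in particular if $i=j$). The symbol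 $\circ$ denotes the Hadamard (entrywise) product of matrices. *)

theory Defs
  imports "HOL-Analysis.Analysis"
begin

definition diag_mat :: "real^'n \<Rightarrow> real^'n^'n" where
  "diag_mat l = (\<chi> i j. if i = j then l $ i else 0)"

(* The real power S^a of a symmetric positive definite S = Q diag(l) Q^T is Q diag(l^a) Q^T;
   lemma mat_powr_eq below shows that it does not depend on the diagonalisation. *)
definition mat_powr :: "real^'n^'n \<Rightarrow> real \<Rightarrow> real^'n^'n" where
  "mat_powr S a = (THE M. \<exists>Q l. orthogonal_matrix Q \<and> (\<forall>i. 0 < l $ i) \<and>
      S = Q ** diag_mat l ** transpose Q \<and>
      M = Q ** diag_mat (\<chi> i. (l $ i) powr a) ** transpose Q)"

lemma diag_mat_mult_left: "(diag_mat l ** W) $ i $ j = l $ i * W $ i $ j"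
  by (simp add: diag_mat_def matrix_matrix_mult_def if_distrib [of "\<lambda>x. x * _"] cong: if_cong)

lemma diag_mat_mult_right: "(W ** diag_mat l) $ i $ j = W $ i $ j * l $ j"
  by (simp add: diag_mat_def matrix_matrix_mult_def if_distrib [of "\<lambda>x. _ * x"] cong: if_cong)

lemma mat_powr_unique:
  fixes Q R :: "real^'n^'n"
  assumes Q: "orthogonal_matrix Q" and R: "orthogonal_matrix R"
    and l: "\<forall>i. 0 < l $ i" and m: "\<forall>i. 0 < m $ i"
    and eq: "Q ** diag_mat l ** transpose Q = R ** diag_mat m ** transpose R"
  shows "Q ** diag_mat (\<chi> i. (l $ i) powr a) ** transpose Q
       = R ** diag_mat (\<chi> i. (m $ i) powr a) ** transpose R"
proof -
  have QQ: "transpose Q ** Q = mat 1" "Q ** transpose Q = mat 1"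
    and RR: "transpose R ** R = mat 1" "R ** transpose R = mat 1"
    using Q R by (auto simp: orthogonal_matrix_def)
  define W where "W = transpose R ** Q"
  have "transpose R ** (Q ** diag_mat l ** transpose Q) ** Q
      = transpose R ** (R ** diag_mat m ** transpose R) ** Q"
    by (simp add: eq)
  then have "W ** diag_mat l ** (transpose Q ** Q) = (transpose R ** R) ** diag_mat m ** W"
    by (simp only: W_def matrix_mul_assoc)
  then have W: "W ** diag_mat l = diag_mat m ** W"
    by (simp add: QQ RR)
  have "W $ i $ j * l $ j powr a = m $ i powr a * W $ i $ j" for i j
  proof (cases "W $ i $ j = 0")
    case False
    have "W $ i $ j * l $ j = m $ i * W $ i $ j"
      using W by (metis diag_mat_mult_left diag_mat_mult_right)
    with False have "l $ j = m $ i" by simp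
    then show ?thesis by simp
  qed simp
  then have W': "W ** diag_mat (\<chi> i. (l $ i) powr a) = diag_mat (\<chi> i. (m $ i) powr a) ** W"
    by (simp add: vec_eq_iff diag_mat_mult_left diag_mat_mult_right)
  have "R ** (W ** diag_mat (\<chi> i. (l $ i) powr a)) ** transpose Q
      = R ** (diag_mat (\<chi> i. (m $ i) powr a) ** W) ** transpose Q"
    by (simp add: W')
  then have "(R ** transpose R) ** Q ** diag_mat (\<chi> i. (l $ i) powr a) ** transpose Q
      = R ** diag_mat (\<chi> i. (m $ i) powr a) ** transpose R ** (Q ** transpose Q)"
    by (simp only: W_def matrix_mul_assoc)
  then show ?thesis
    by (simp add: QQ RR)
qed

lemma mat_powr_eq:
  assumes "orthogonal_matrix Q" and "\<forall>i. 0 < l $ i"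
  shows "mat_powr (Q ** diag_mat l ** transpose Q) a
       = Q ** diag_mat (\<chi> i. (l $ i) powr a) ** transpose Q"
  unfolding mat_powr_def
proof (rule the_equality)
  show "\<exists>Q' l'. orthogonal_matrix Q' \<and> (\<forall>i. 0 < l' $ i) \<and>
      Q ** diag_mat l ** transpose Q = Q' ** diag_mat l' ** transpose Q' \<and>
      Q ** diag_mat (\<chi> i. (l $ i) powr a) ** transpose Q
        = Q' ** diag_mat (\<chi> i. (l' $ i) powr a) ** transpose Q'"
    using assms by blast
next
  fix M
  assume "\<exists>Q' l'. orthogonal_matrix Q' \<and> (\<forall>i. 0 < l' $ i) \<and>
      Q ** diag_mat l ** transpose Q = Q' ** diag_mat l' ** transpose Q' \<and>
      M = Q' ** diag_mat (\<chi> i. (l' $ i) powr a) ** transpose Q'"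
  then obtain Q' l' where "orthogonal_matrix Q'" "\<forall>i. 0 < l' $ i"
      "Q ** diag_mat l ** transpose Q = Q' ** diag_mat l' ** transpose Q'"
      "M = Q' ** diag_mat (\<chi> i. (l' $ i) powr a) ** transpose Q'"
    by blast
  with assms show "M = Q ** diag_mat (\<chi> i. (l $ i) powr a) ** transpose Q"
    using mat_powr_unique[of Q Q' l l' a] by simp
qed

definition A_op :: "nat \<Rightarrow> real^'n^'n \<Rightarrow> real^'n^'n \<Rightarrow> real^'n^'n" where
  "A_op N X Z = (\<Sum>p = 1..N.
      mat_powr (X ** transpose X) ((real N - real p) / real N) ** Z **
      mat_powr (transpose X ** X) ((real p - 1) / real N))"

(* The bilinear form at X whose quadratic form is the squared norm Tr (Z^T A_{N,X}^{-1} Z). *)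
definition g_metric :: "nat \<Rightarrow> real^'n^'n \<Rightarrow> real^'n^'n \<Rightarrow> real^'n^'n \<Rightarrow> real" where
  "g_metric N X Z W = trace (transpose Z ** inv (A_op N X) W)"

(* One-sided derivatives at the end points of [0,1]; the library's C1_differentiable_on
   would depend on values outside the interval. *)
definition C1_path :: "(real \<Rightarrow> 'a::real_normed_vector) \<Rightarrow> bool" where
  "C1_path x \<longleftrightarrow> (\<exists>x'. continuous_on {0..1} x' \<and>
      (\<forall>t\<in>{0..1}. (x has_vector_derivative x' t) (at t within {0..1})))"

definition action :: "('a::real_normed_vector \<Rightarrow> 'a \<Rightarrow> 'a \<Rightarrow> real) \<Rightarrow> (real \<Rightarrow> 'a) \<Rightarrow> real" where
  "action g x = integral {0..1} (\<lambda>t.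
      g (x t) (vector_derivative x (at t within {0..1})) (vector_derivative x (at t within {0..1})))"

(* Geodesics of a metric g on an open subset M of a normed space. The C1 paths in M from A to B
   form an open subset of an affine space over the C1 fields h with h 0 = h 1 = 0, so x is a
   critical point of the action when the derivative in each such direction h is zero. For a given
   h the path x + s h stays in M for all small s, and the derivative at s = 0 sees no others. *)
definition geodesic_between ::
  "'a::real_normed_vector set \<Rightarrow> ('a \<Rightarrow> 'a \<Rightarrow> 'a \<Rightarrow> real) \<Rightarrow> 'a \<Rightarrow> 'a \<Rightarrow> (real \<Rightarrow> 'a) \<Rightarrow> bool" where
  "geodesic_between M g A B x \<longleftrightarrow>
     C1_path x \<and> (\<forall>t\<in>{0..1}. x t \<in> M) \<and> x 0 = A \<and> x 1 = B \<and>
     (\<forall>h. C1_path h \<and> h 0 = 0 \<and> h 1 = 0 \<longrightarrow>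
        ((\<lambda>s. action g (\<lambda>t. x t + s *\<^sub>R h t)) has_real_derivative 0) (at 0))"

definition is_svd :: "real^'n^'n \<Rightarrow> real^'n^'n \<Rightarrow> real^'n^'n \<Rightarrow> real^'n^'n \<Rightarrow> bool" where
  "is_svd X U S V \<longleftrightarrow> orthogonal_matrix U \<and> orthogonal_matrix V \<and>
     (\<forall>i j. i \<noteq> j \<longrightarrow> S $ i $ j = 0) \<and> (\<forall>i. 0 < S $ i $ i) \<and> X = U ** S ** transpose V"

definition hadamard :: "real^'n^'n \<Rightarrow> real^'n^'n \<Rightarrow> real^'n^'n" where
  "hadamard P Q = (\<chi> i j. P $ i $ j * Q $ i $ j)"

(* L is meant to be diagonal with positive entries; only its diagonal is used. *)
definition f1 :: "real \<Rightarrow> real^'n^'n \<Rightarrow> real^'n^'n" where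
  "f1 a L = (\<chi> i j.
     if L $ i $ i \<noteq> L $ j $ j
     then ((L $ i $ i) powr a - (L $ j $ j) powr a) / (L $ i $ i - L $ j $ j)
     else a * (L $ i $ i) powr (a - 1))"

definition M1 :: "nat \<Rightarrow> nat \<Rightarrow> real^'n^'n \<Rightarrow> real^'n^'n \<Rightarrow> real^'n^'n \<Rightarrow> real^'n^'n \<Rightarrow> real^'n^'n" where
  "M1 N p U S V P = (let W = transpose U ** P ** V in
     W ** mat_powr S (2 * (real p - 1) / real N) ** transpose W)"

definition M2 :: "nat \<Rightarrow> nat \<Rightarrow> real^'n^'n \<Rightarrow> real^'n^'n \<Rightarrow> real^'n^'n \<Rightarrow> real^'n^'n \<Rightarrow> real^'n^'n" where
  "M2 N p U S V P = (let W = transpose U ** P ** V in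
     transpose W ** mat_powr S (2 * (real N - real p) / real N) ** W)"

end

theory Submission
  imports Defs
begin

text \<open>
  For positive definite \<open>S = Q diag(l) Q\<^sup>T\<close> and \<open>T = R diag(m) R\<^sup>T\<close>, multiplying the entries of
  \<open>Q\<^sup>T K R\<close> by \<open>\<phi>(l\<^sub>i, m\<^sub>j)\<close> gives an operator that does not depend on the eigenbases and, by
  compactness of the orthogonal group, depends continuously on \<open>(S, T, K)\<close>. The operator
  \<open>A\<^sub>N\<^sub>,\<^sub>X\<close>, its inverse and the increments \<open>S\<^sup>a - T\<^sup>a\<close> (with the divided difference of \<open>x\<^sup>a\<close> as
  symbol, applied to \<open>S - T\<close>) all have this form, so the metric is differentiable along line
  segments with continuous derivative. With \<open>P = A\<^sup>-\<^sup>1 X'\<close> the first variation of the action in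
  direction \<open>h\<close> is \<open>2 \<integral> \<langle>h', P\<rangle> - \<langle>h, G(X, P)\<rangle>\<close>, where \<open>G\<close> is half the gradient of
  \<open>X \<mapsto> \<langle>P, A\<^sub>N\<^sub>,\<^sub>X P\<rangle>\<close>. By the lemma of du Bois-Reymond it vanishes for all \<open>h\<close> iff
  \<open>P' = - G(X, P)\<close>, and in singular value coordinates \<open>G\<close> is the matrix of the theorem.
\<close>

section \<open>Double operator integrals\<close>

lemma bounded_bilinear_matrix_mult:
  "bounded_bilinear ((**) :: real^'n^'m \<Rightarrow> real^'k^'n \<Rightarrow> real^'k^'m)"
proof -
  have "bilinear ((**) :: real^'n^'m \<Rightarrow> real^'k^'n \<Rightarrow> real^'k^'m)"
    unfolding bilinear_def
    by (intro conjI allI linearI)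
      (simp_all add: vec_eq_iff matrix_matrix_mult_def algebra_simps sum.distrib sum_distrib_left)
  then show ?thesis
    by (simp add: bilinear_conv_bounded_bilinear)
qed

lemma bounded_linear_transpose: "bounded_linear (transpose :: real^'n^'m \<Rightarrow> real^'m^'n)"
  unfolding linear_conv_bounded_linear[symmetric]
  by (intro linearI) (simp_all add: vec_eq_iff transpose_def)

lemmas matrix_mult_sum_left = bounded_bilinear.sum_left [OF bounded_bilinear_matrix_mult]
  and matrix_mult_sum_right = bounded_bilinear.sum_right [OF bounded_bilinear_matrix_mult]
  and matrix_mult_add_left = bounded_bilinear.add_left [OF bounded_bilinear_matrix_mult]
  and matrix_mult_add_right = bounded_bilinear.add_right [OF bounded_bilinear_matrix_mult]
  and matrix_mult_diff_left = bounded_bilinear.diff_left [OF bounded_bilinear_matrix_mult]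
  and matrix_mult_diff_right = bounded_bilinear.diff_right [OF bounded_bilinear_matrix_mult]
  and matrix_mult_scaleR_left = bounded_bilinear.scaleR_left [OF bounded_bilinear_matrix_mult]
  and matrix_mult_scaleR_right = bounded_bilinear.scaleR_right [OF bounded_bilinear_matrix_mult]
  and tendsto_matrix_mult [tendsto_intros] = bounded_bilinear.tendsto [OF bounded_bilinear_matrix_mult]
  and continuous_on_matrix_mult [continuous_intros] =
    bounded_bilinear.continuous_on [OF bounded_bilinear_matrix_mult]
  and tendsto_transpose [tendsto_intros] = bounded_linear.tendsto [OF bounded_linear_transpose]
  and continuous_on_transpose [continuous_intros] =
    bounded_linear.continuous_on [OF bounded_linear_transpose]
  and transpose_add = linear_add [OF bounded_linear.linear [OF bounded_linear_transpose]]
  and transpose_scaleR = linear_scale [OF bounded_linear.linear [OF bounded_linear_transpose]]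

lemma trace_transpose_mult: "trace (transpose A ** B) = A \<bullet> (B :: real^'n^'n)"
  unfolding trace_def transpose_def matrix_matrix_mult_def inner_vec_def inner_real_def
  by (simp, rule sum.swap)

lemma inner_matrix_mult_left:
  fixes A B C :: "real^'n^'n"
  shows "(A ** B) \<bullet> C = B \<bullet> (transpose A ** C)"
  by (simp add: trace_transpose_mult [symmetric] matrix_transpose_mul matrix_mul_assoc)

lemma inner_matrix_mult_right:
  fixes A B C :: "real^'n^'n"
  shows "(A ** B) \<bullet> C = A \<bullet> (C ** transpose B)"
proof -
  have "(A ** B) \<bullet> C = trace (transpose B ** (transpose A ** C))"
    by (simp add: trace_transpose_mult [symmetric] matrix_transpose_mul matrix_mul_assoc)
  also have "\<dots> = trace ((transpose A ** C) ** transpose B)"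
    by (rule trace_mul_sym)
  also have "\<dots> = A \<bullet> (C ** transpose B)"
    by (simp add: trace_transpose_mult [symmetric] matrix_mul_assoc)
  finally show ?thesis .
qed

lemma inner_transpose: "transpose A \<bullet> transpose B = A \<bullet> (B :: real^'n^'n)"
  unfolding transpose_def inner_vec_def inner_real_def
  by (simp, rule sum.swap)

text \<open>The first factors are the derivatives of the two Gram matrices in direction
  \<open>H\<close>. Their two summands are transposes of each other and pair equally with a
  symmetric \<open>G\<close>, hence the factor 2.\<close>

lemma inner_symmetrized:
  fixes H X G :: "real^'n^'n"
  assumes "transpose G = G"
  shows "(H ** transpose X + X ** transpose H) \<bullet> G = 2 * (H \<bullet> (G ** X))"
    and "(transpose H ** X + transpose X ** H) \<bullet> G = 2 * (H \<bullet> (X ** G))"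
proof -
  have "(X ** transpose H) \<bullet> G = (H ** transpose X) \<bullet> G"
    using inner_transpose [of "H ** transpose X" G] assms by (simp add: matrix_transpose_mul)
  then show "(H ** transpose X + X ** transpose H) \<bullet> G = 2 * (H \<bullet> (G ** X))"
    by (simp add: inner_add_left inner_matrix_mult_right)
  have "(transpose H ** X) \<bullet> G = (transpose X ** H) \<bullet> G"
    using inner_transpose [of "transpose X ** H" G] assms by (simp add: matrix_transpose_mul)
  then show "(transpose H ** X + transpose X ** H) \<bullet> G = 2 * (H \<bullet> (X ** G))"
    by (simp add: inner_add_left inner_matrix_mult_left)
qed

section \<open>Eigenbases and entrywise multipliers\<close>

definition spectral :: "real^'n^'n \<Rightarrow> real^'n^'n \<Rightarrow> real^'n \<Rightarrow> bool" where
  "spectral S Q l \<longleftrightarrow> orthogonal_matrix Q \<and> (\<forall>i. 0 < l $ i) \<and> S = Q ** diag_mat l ** transpose Q"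

text \<open>Positive definiteness is encoded by a diagonalisation, so that eigenbases are always at
  hand; the spectral theorem enters through \<open>spd_gram\<close>, which supplies the Gram
  matrices.\<close>

definition spd :: "real^'n^'n \<Rightarrow> bool" where
  "spd S \<longleftrightarrow> (\<exists>Q l. spectral S Q l)"

definition schur :: "(real \<Rightarrow> real \<Rightarrow> real) \<Rightarrow> real^'n \<Rightarrow> real^'n \<Rightarrow> real^'n^'n \<Rightarrow> real^'n^'n" where
  "schur \<phi> l m M = (\<chi> i j. \<phi> (l $ i) (m $ j) * M $ i $ j)"

text \<open>The double operator integral with symbol \<open>\<phi>\<close>: in eigenbases of \<open>S\<close> and \<open>T\<close> it multiplies
  the \<open>(i, j)\<close> entry by \<open>\<phi> (l $ i) (m $ j)\<close>. The choice of eigenbases is immaterial by \<open>doi_eq\<close>.\<close>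

definition doi :: "(real \<Rightarrow> real \<Rightarrow> real) \<Rightarrow> real^'n^'n \<Rightarrow> real^'n^'n \<Rightarrow> real^'n^'n \<Rightarrow> real^'n^'n" where
  "doi \<phi> S T K = (SOME Y. \<exists>Q l R m. spectral S Q l \<and> spectral T R m \<and>
     Y = Q ** schur \<phi> l m (transpose Q ** K ** R) ** transpose R)"

text \<open>The scalar kernel behind the entries of \<open>f1\<close>; the derivative on the
  diagonal is the value that makes it continuous there.\<close>

definition divdiff :: "real \<Rightarrow> real \<Rightarrow> real \<Rightarrow> real" where
  "divdiff a x y = (if x \<noteq> y then (x powr a - y powr a) / (x - y) else a * x powr (a - 1))"

lemma orthogonal_matrix_cancel:
  assumes "orthogonal_matrix Q"
  shows "transpose Q ** Q = mat 1" "Q ** transpose Q = mat 1"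
    "A ** transpose Q ** Q = A" "A ** Q ** transpose Q = A"
  using assms by (auto simp: orthogonal_matrix_def matrix_mul_assoc [symmetric])

lemma spectralD:
  assumes "spectral S Q l"
  shows "orthogonal_matrix Q" "\<And>i. 0 < l $ i" "S = Q ** diag_mat l ** transpose Q"
  using assms by (auto simp: spectral_def)

text \<open>The transition matrix \<open>W = transpose Q' ** Q\<close> satisfies
  \<open>W ** diag_mat l = diag_mat l' ** W\<close>; compare entries. The eigenvalues may have any
  sign, since \<open>spectral_subsequence\<close> applies this to a limit whose positivity is still
  to be shown.\<close>

lemma diagonalization_intertwine:
  fixes S Q Q' :: "real^'n^'n"
  assumes Q: "orthogonal_matrix Q" "S = Q ** diag_mat l ** transpose Q"
    and Q': "orthogonal_matrix Q'" "S = Q' ** diag_mat l' ** transpose Q'"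
    and nz: "(transpose Q' ** Q) $ i $ j \<noteq> 0"
  shows "l' $ i = l $ j"
proof -
  note o = orthogonal_matrix_cancel [OF Q(1)] orthogonal_matrix_cancel [OF Q'(1)]
  have "transpose Q' ** Q ** diag_mat l = transpose Q' ** (Q ** diag_mat l ** transpose Q) ** Q"
    by (simp add: matrix_mul_assoc o)
  also have "\<dots> = transpose Q' ** (Q' ** diag_mat l' ** transpose Q') ** Q"
    using Q(2) Q'(2) by simp
  also have "\<dots> = diag_mat l' ** (transpose Q' ** Q)"
    by (simp add: matrix_mul_assoc o)
  finally have "(transpose Q' ** Q) $ i $ j * l $ j = l' $ i * (transpose Q' ** Q) $ i $ j"
    by (metis diag_mat_mult_left diag_mat_mult_right)
  with nz show ?thesis by simp
qed

lemma spectral_intertwine: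
  assumes "spectral S Q l" "spectral S Q' l'" "(transpose Q' ** Q) $ i $ j \<noteq> 0"
  shows "l' $ i = l $ j"
  using assms diagonalization_intertwine unfolding spectral_def by blast

text \<open>In every nonzero term of the double sum the inner eigenvalues equal the outer ones, so
  \<open>\<phi>\<close> can be evaluated at the outer indices and pulled out.\<close>

lemma schur_intertwine:
  fixes W Z M :: "real^'n^'n"
  assumes "\<And>i j. W $ i $ j \<noteq> 0 \<Longrightarrow> l' $ i = l $ j" and "\<And>i j. Z $ i $ j \<noteq> 0 \<Longrightarrow> m $ i = m' $ j"
  shows "W ** schur \<phi> l m M ** Z = schur \<phi> l' m' (W ** M ** Z)"
proof -
  have "W $ i $ k * (\<phi> (l $ k) (m $ q) * M $ k $ q) * Z $ q $ j
      = \<phi> (l' $ i) (m' $ j) * (W $ i $ k * M $ k $ q * Z $ q $ j)" for i j k q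
    using assms(1) [of i k] assms(2) [of q j]
    by (cases "W $ i $ k = 0"; cases "Z $ q $ j = 0") auto
  then have "(\<Sum>q\<in>UNIV. \<Sum>k\<in>UNIV. W $ i $ k * (\<phi> (l $ k) (m $ q) * M $ k $ q) * Z $ q $ j)
      = (\<Sum>q\<in>UNIV. \<Sum>k\<in>UNIV. \<phi> (l' $ i) (m' $ j) * (W $ i $ k * M $ k $ q * Z $ q $ j))" for i j
    by presburger
  then show ?thesis
    unfolding vec_eq_iff schur_def matrix_matrix_mult_def
    by (simp add: sum_distrib_left sum_distrib_right)
qed

text \<open>The eigenbases picked by \<open>SOME\<close> differ from the given ones by transition
  matrices that couple only equal eigenvalues, and these pass through the multiplier by
  \<open>schur_intertwine\<close>.\<close>

lemma doi_eq:
  assumes S: "spectral S Q l" and T: "spectral T R m"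
  shows "doi \<phi> S T K = Q ** schur \<phi> l m (transpose Q ** K ** R) ** transpose R"
proof -
  define Y where "Y = doi \<phi> S T K"
  have "\<exists>Q l R m. spectral S Q l \<and> spectral T R m \<and>
      Y = Q ** schur \<phi> l m (transpose Q ** K ** R) ** transpose R"
    unfolding Y_def doi_def by (rule someI_ex) (use assms in blast)
  then obtain Q' l' R' m' where S': "spectral S Q' l'" and T': "spectral T R' m'"
    and Y: "Y = Q' ** schur \<phi> l' m' (transpose Q' ** K ** R') ** transpose R'"
    by blast
  note o = orthogonal_matrix_cancel [OF spectralD(1) [OF S]] orthogonal_matrix_cancel [OF spectralD(1) [OF T]]
    orthogonal_matrix_cancel [OF spectralD(1) [OF S']] orthogonal_matrix_cancel [OF spectralD(1) [OF T']]
  have W: "(transpose Q ** Q') $ i $ j \<noteq> 0 \<Longrightarrow> l $ i = l' $ j" for i j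
    by (rule spectral_intertwine [OF S' S])
  have Z: "(transpose R' ** R) $ i $ j \<noteq> 0 \<Longrightarrow> m' $ i = m $ j" for i j
    by (rule spectral_intertwine [OF T T'])
  have "Y = Q ** (transpose Q ** Q' ** schur \<phi> l' m' (transpose Q' ** K ** R') ** (transpose R' ** R)) ** transpose R"
    unfolding Y by (simp add: matrix_mul_assoc o)
  also have "\<dots> = Q ** schur \<phi> l m (transpose Q ** Q' ** (transpose Q' ** K ** R') ** (transpose R' ** R)) ** transpose R"
    by (subst schur_intertwine [OF W Z]) auto
  also have "\<dots> = Q ** schur \<phi> l m (transpose Q ** K ** R) ** transpose R"
    by (simp add: matrix_mul_assoc o)
  finally show ?thesis by (simp add: Y_def)
qed

lemma mat_powr_spectral:
  "spectral S Q l \<Longrightarrow> mat_powr S a = Q ** diag_mat (\<chi> i. l $ i powr a) ** transpose Q"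
  unfolding spectral_def using mat_powr_eq by blast

context
  fixes S T :: "real^'n^'n"
  assumes S: "spd S" and T: "spd T"
begin

lemma spd_pair_obtain:
  obtains Q l R m where "spectral S Q l" "spectral T R m"
  using S T unfolding spd_def by blast

lemma doi_scaleR: "doi \<phi> S T (c *\<^sub>R K) = c *\<^sub>R doi \<phi> S T K"
proof -
  obtain Q l R m where *: "spectral S Q l" "spectral T R m" by (rule spd_pair_obtain)
  have "schur \<phi> l m (c *\<^sub>R M) = c *\<^sub>R schur \<phi> l m M" for M
    by (simp add: schur_def vec_eq_iff)
  then show ?thesis
    by (simp add: doi_eq [OF *] matrix_mult_scaleR_left matrix_mult_scaleR_right)
qed

lemma doi_doi: "doi \<phi> S T (doi \<psi> S T K) = doi (\<lambda>x y. \<phi> x y * \<psi> x y) S T K"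
proof -
  obtain Q l R m where *: "spectral S Q l" "spectral T R m" by (rule spd_pair_obtain)
  note o = orthogonal_matrix_cancel [OF spectralD(1) [OF *(1)]]
    orthogonal_matrix_cancel [OF spectralD(1) [OF *(2)]]
  have "schur \<phi> l m (schur \<psi> l m M) = schur (\<lambda>x y. \<phi> x y * \<psi> x y) l m M" for M
    by (simp add: schur_def vec_eq_iff)
  then show ?thesis
    by (simp add: doi_eq [OF *] matrix_mul_assoc o)
qed

lemma doi_cong:
  assumes "\<And>x y. x > 0 \<Longrightarrow> y > 0 \<Longrightarrow> \<phi> x y = \<psi> x y"
  shows "doi \<phi> S T K = doi \<psi> S T K"
proof -
  obtain Q l R m where *: "spectral S Q l" "spectral T R m" by (rule spd_pair_obtain)
  have "schur \<phi> l m M = schur \<psi> l m M" for M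
    using assms spectralD(2) [OF *(1)] spectralD(2) [OF *(2)] by (simp add: schur_def vec_eq_iff)
  then show ?thesis
    by (simp add: doi_eq [OF *])
qed

lemma doi_one: "doi (\<lambda>_ _. 1) S T K = K"
proof -
  obtain Q l R m where *: "spectral S Q l" "spectral T R m" by (rule spd_pair_obtain)
  note o = orthogonal_matrix_cancel [OF spectralD(1) [OF *(1)]]
    orthogonal_matrix_cancel [OF spectralD(1) [OF *(2)]]
  have "schur (\<lambda>_ _. 1) l m M = M" for M
    by (simp add: schur_def vec_eq_iff)
  then show ?thesis
    by (simp add: doi_eq [OF *] matrix_mul_assoc o)
qed

lemma doi_sum: "doi (\<lambda>x y. \<Sum>p\<in>I. \<phi> p x y) S T K = (\<Sum>p\<in>I. doi (\<phi> p) S T K)"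
proof -
  obtain Q l R m where *: "spectral S Q l" "spectral T R m" by (rule spd_pair_obtain)
  have "schur (\<lambda>x y. \<Sum>p\<in>I. \<phi> p x y) l m M = (\<Sum>p\<in>I. schur (\<phi> p) l m M)" for M
    by (simp add: schur_def vec_eq_iff sum_distrib_right)
  then show ?thesis
    by (simp add: doi_eq [OF *] matrix_mult_sum_left matrix_mult_sum_right)
qed

lemma doi_powr:
  "doi (\<lambda>x y. x powr a * y powr b) S T K = mat_powr S a ** K ** mat_powr T b"
proof -
  obtain Q l R m where *: "spectral S Q l" "spectral T R m" by (rule spd_pair_obtain)
  have "schur (\<lambda>x y. x powr a * y powr b) l m M
      = diag_mat (\<chi> i. l $ i powr a) ** M ** diag_mat (\<chi> i. m $ i powr b)" for M
    by (simp add: schur_def vec_eq_iff diag_mat_mult_left diag_mat_mult_right)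
  then show ?thesis
    by (simp add: doi_eq [OF *] mat_powr_spectral [OF *(1)] mat_powr_spectral [OF *(2)]
        matrix_mul_assoc)
qed

text \<open>Orthogonal changes of basis preserve the Frobenius product, and multiplying entries by
  real numbers is symmetric.\<close>

lemma doi_self_adjoint: "K \<bullet> doi \<phi> S T L = doi \<phi> S T K \<bullet> L"
proof -
  obtain Q l R m where *: "spectral S Q l" "spectral T R m" by (rule spd_pair_obtain)
  have "X \<bullet> (Q ** Y ** transpose R) = (transpose Q ** X ** R) \<bullet> Y" for X Y
  proof -
    have "X \<bullet> (Q ** Y ** transpose R) = (Q ** Y) \<bullet> (X ** R)"
      using inner_matrix_mult_right [of "Q ** Y" "transpose R" X] by (simp add: inner_commute)
    also have "\<dots> = Y \<bullet> (transpose Q ** X ** R)"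
      by (simp add: inner_matrix_mult_left matrix_mul_assoc)
    finally show ?thesis by (simp add: inner_commute)
  qed
  moreover have "M \<bullet> schur \<phi> l m M' = schur \<phi> l m M \<bullet> M'" for M M'
    by (simp add: schur_def inner_vec_def mult_ac)
  ultimately show ?thesis
    by (metis doi_eq [OF *] inner_commute)
qed

text \<open>In mixed eigenbases the entries of \<open>S - T\<close> are
  \<open>(l $ i - m $ j) * W $ i $ j\<close>, and the divided difference turns the first factor into
  the difference of the powers. This is an exact increment formula, with no remainder term.\<close>

lemma mat_powr_diff: "mat_powr S a - mat_powr T a = doi (divdiff a) S T (S - T)"
proof -
  obtain Q l R m where *: "spectral S Q l" "spectral T R m" by (rule spd_pair_obtain)
  note o = orthogonal_matrix_cancel [OF spectralD(1) [OF *(1)]]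
    orthogonal_matrix_cancel [OF spectralD(1) [OF *(2)]]
  let ?l = "\<chi> i. l $ i powr a" and ?m = "\<chi> i. m $ i powr a"
  define W where "W = transpose Q ** R"
  have "divdiff a (l $ i) (m $ j) * (l $ i * W $ i $ j - W $ i $ j * m $ j)
      = l $ i powr a * W $ i $ j - W $ i $ j * m $ j powr a" for i j
    by (cases "l $ i = m $ j") (auto simp: divdiff_def field_simps)
  then have D: "schur (divdiff a) l m (diag_mat l ** W - W ** diag_mat m)
      = diag_mat ?l ** W - W ** diag_mat ?m"
    by (simp add: schur_def vec_eq_iff diag_mat_mult_left diag_mat_mult_right)
  have "transpose Q ** (S - T) ** R = diag_mat l ** W - W ** diag_mat m"
    by (simp add: spectralD(3) [OF *(1)] spectralD(3) [OF *(2)] W_def matrix_mult_diff_left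
        matrix_mult_diff_right matrix_mul_assoc o)
  then have "doi (divdiff a) S T (S - T) = Q ** (diag_mat ?l ** W - W ** diag_mat ?m) ** transpose R"
    by (simp add: doi_eq [OF *] D)
  also have "\<dots> = mat_powr S a - mat_powr T a"
    by (simp add: mat_powr_spectral [OF *(1)] mat_powr_spectral [OF *(2)] W_def
        matrix_mult_diff_left matrix_mult_diff_right matrix_mul_assoc o)
  finally show ?thesis ..
qed

end

section \<open>The spectral theorem\<close>

lemma compact_orthogonal_matrices: "compact {Q :: real^'n^'n. orthogonal_matrix Q}"
proof -
  have "closed {Q :: real^'n^'n. transpose Q ** Q = mat 1}"
    by (intro closed_Collect_eq continuous_intros)
  moreover have "norm Q = sqrt (trace (mat 1 :: real^'n^'n))"
    if "transpose Q ** Q = mat 1" for Q :: "real^'n^'n"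
    using that trace_transpose_mult [of Q Q] by (simp add: norm_eq_sqrt_inner)
  then have "bounded {Q :: real^'n^'n. transpose Q ** Q = mat 1}"
    unfolding bounded_iff by (metis (mono_tags, lifting) mem_Collect_eq order_refl)
  ultimately show ?thesis
    by (simp add: compact_eq_bounded_closed orthogonal_matrix)
qed

text \<open>The function of the angle attains its maximum 0 at angle 0, where its derivative is
  \<open>D * (2 * \<mu>)\<close>. In the application \<open>D\<close> is a difference of weights,
  \<open>\<delta>\<close> a difference of diagonal entries and \<open>\<mu>\<close> the off-diagonal
  entry.\<close>

lemma plane_rotation_critical:
  fixes D \<delta> \<mu> :: real
  assumes "\<And>x. D * ((sin x)\<^sup>2 * \<delta> + 2 * (cos x * sin x * \<mu>)) \<le> 0" and "D \<noteq> 0"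
  shows "\<mu> = 0"
proof -
  let ?f = "\<lambda>x. D * ((sin x)\<^sup>2 * \<delta> + 2 * (cos x * sin x * \<mu>))"
  have "(?f has_real_derivative D * (2 * \<mu>)) (at 0)"
    by (auto intro!: derivative_eq_intros)
  then have "D * (2 * \<mu>) = 0"
    by (rule DERIV_local_max [where d = 1]) (use assms(1) in auto)
  with assms(2) show ?thesis by simp
qed

lemma inner_columns: "(transpose A ** B) $ i $ j = column i A \<bullet> column j (B :: real^'n^'n)"
  by (simp add: matrix_matrix_mult_def transpose_def column_def inner_vec_def)

text \<open>Von Neumann's argument: maximise \<open>\<Sum>k. c k * (Q\<^sup>T S Q) $ k $ k\<close> with distinct weights
  \<open>c k\<close> over the compact orthogonal group; stationarity under the rotation of the
  \<open>(i, j)\<close> coordinate plane says that the \<open>(i, j)\<close> entry vanishes.\<close>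
lemma symmetric_diagonalizable:
  fixes S :: "real^'n^'n"
  assumes sym: "transpose S = S"
  obtains Q l where "orthogonal_matrix Q" "S = Q ** diag_mat l ** transpose Q"
proof -
  obtain e :: "'n \<Rightarrow> nat" where "inj e"
    using finite_imp_inj_to_nat_seg [of "UNIV :: 'n set"] by auto
  define c where "c k = real (e k)" for k
  have c: "c i \<noteq> c j" if "i \<noteq> j" for i j
    using that \<open>inj e\<close> by (auto simp: c_def inj_def)
  define F where "F Q = (\<Sum>k\<in>UNIV. c k * (transpose Q ** S ** Q) $ k $ k)" for Q
  have "continuous_on {Q. orthogonal_matrix Q} F"
    unfolding F_def by (intro continuous_intros)
  moreover have "{Q :: real^'n^'n. orthogonal_matrix Q} \<noteq> {}"
    using orthogonal_matrix_id by blast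
  ultimately obtain Q where Q: "orthogonal_matrix Q"
    and max: "\<And>R. orthogonal_matrix R \<Longrightarrow> F R \<le> F Q"
    using continuous_attains_sup [OF compact_orthogonal_matrices] by blast
  define M where "M = transpose Q ** S ** Q"
  have symM: "M $ j $ i = M $ i $ j" for i j
  proof -
    have "transpose M = M"
      by (simp add: M_def matrix_transpose_mul sym matrix_mul_assoc)
    then show ?thesis by (metis transpose_def vec_lambda_beta)
  qed
  have off: "M $ i $ j = 0" if ij: "i \<noteq> j" for i j
  proof (rule plane_rotation_critical)
    show "c i - c j \<noteq> 0" using c [OF ij] by simp
    fix x :: real
    \<comment> \<open>The columns of the rotation by the angle \<open>x\<close> in the plane of the
      coordinates \<open>i\<close> and \<open>j\<close>.\<close>
    define g where "g k = (if k = i then cos x *\<^sub>R axis i 1 + sin x *\<^sub>R axis j 1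
        else if k = j then cos x *\<^sub>R axis j 1 - sin x *\<^sub>R axis i 1 else axis k (1::real))" for k
    define G where "G = transpose (\<chi> k. g k)"
    have col: "column k G = g k" for k
      by (simp add: G_def column_transpose row_def)
    have "transpose G ** G = mat 1"
      unfolding vec_eq_iff inner_columns col mat_def using ij
      by (auto simp: g_def inner_axis_axis algebra_simps simp flip: power2_eq_square)
    then have G: "orthogonal_matrix G" by (simp add: orthogonal_matrix)
    have entry: "axis a 1 \<bullet> (M *v axis b 1) = M $ a $ b" for a b
      by (simp add: inner_commute [of "axis a 1"] inner_axis matrix_vector_mul_component
          row_def)
    have diag: "(transpose G ** M ** G) $ k $ k = g k \<bullet> (M *v g k)" for k
    proof -
      have "(transpose G ** M ** G) $ k $ k = (transpose G ** (M ** G)) $ k $ k"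
        by (simp add: matrix_mul_assoc)
      also have "\<dots> = g k \<bullet> column k (M ** G)"
        by (simp only: inner_columns col)
      also have "column k (M ** G) = M *v column k G"
        by (simp add: vec_eq_iff column_def matrix_vector_mult_def matrix_matrix_mult_def)
      finally show ?thesis by (simp add: col)
    qed
    \<comment> \<open>The identity cos^2 = 1 - sin^2 in the shape that products have after
      \<open>algebra_simps\<close>.\<close>
    have cc: "cos x * (cos x * y) = y - sin x * (sin x * y)" for y
    proof -
      have "cos x * (cos x * y) = (cos x)\<^sup>2 * y" by (simp add: power2_eq_square)
      then show ?thesis unfolding cos_squared_eq by (simp add: power2_eq_square algebra_simps)
    qed
    have "F (Q ** G) = (\<Sum>k\<in>UNIV. c k * (transpose G ** M ** G) $ k $ k)"
      by (simp add: F_def M_def matrix_transpose_mul matrix_mul_assoc)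
    moreover have "F Q = (\<Sum>k\<in>UNIV. c k * M $ k $ k)"
      by (simp add: F_def M_def)
    moreover have "F (Q ** G) \<le> F Q"
      using max orthogonal_matrix_mul [OF Q G] by blast
    ultimately have "0 \<ge> (\<Sum>k\<in>UNIV. c k * (g k \<bullet> (M *v g k)) - c k * M $ k $ k)"
      by (simp add: sum_subtractf diag)
    also have "(\<Sum>k\<in>UNIV. c k * (g k \<bullet> (M *v g k)) - c k * M $ k $ k)
        = (\<Sum>k\<in>{i, j}. c k * (g k \<bullet> (M *v g k)) - c k * M $ k $ k)"
      by (rule sum.mono_neutral_right) (auto simp: g_def entry)
    also have "\<dots> = c i * ((g i \<bullet> (M *v g i)) - M $ i $ i) + c j * ((g j \<bullet> (M *v g j)) - M $ j $ j)"
      using ij by (simp add: algebra_simps)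
    also have "g i \<bullet> (M *v g i) - M $ i $ i
        = (sin x)\<^sup>2 * (M $ j $ j - M $ i $ i) + 2 * (cos x * sin x * M $ i $ j)"
      by (simp add: g_def matrix_vector_right_distrib matrix_vector_mult_scaleR inner_add_left
          inner_add_right entry symM [of i j] cc algebra_simps
          power2_eq_square)
    \<comment> \<open>The opposite of the increment at \<open>i\<close>, because the rotation
      preserves the trace.\<close>
    also have "g j \<bullet> (M *v g j) - M $ j $ j
        = - ((sin x)\<^sup>2 * (M $ j $ j - M $ i $ i) + 2 * (cos x * sin x * M $ i $ j))"
      using ij
      by (simp add: g_def matrix_vector_mult_diff_distrib matrix_vector_mult_scaleR inner_diff_left
          inner_diff_right entry symM [of i j] cc algebra_simps
          power2_eq_square)
    finally show "(c i - c j) * ((sin x)\<^sup>2 * (M $ j $ j - M $ i $ i)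
        + 2 * (cos x * sin x * M $ i $ j)) \<le> 0"
      by (simp add: algebra_simps)
  qed
  have "M = diag_mat (\<chi> k. M $ k $ k)"
    using off by (simp add: vec_eq_iff diag_mat_def)
  moreover have "S = Q ** M ** transpose Q"
    by (simp add: M_def matrix_mul_assoc orthogonal_matrix_cancel [OF Q])
  ultimately show ?thesis using that Q by metis
qed

text \<open>In an eigenbasis \<open>Q\<close> of the Gram matrix, \<open>l $ k\<close> is the
  squared length of column \<open>k\<close> of \<open>X ** Q\<close>, which is nonzero because
  \<open>X ** Q\<close> is invertible.\<close>

lemma spd_gram:
  fixes X :: "real^'n^'n"
  assumes "invertible X"
  shows "spd (transpose X ** X)"
proof -
  have "transpose (transpose X ** X) = transpose X ** X"
    by (simp add: matrix_transpose_mul)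
  then obtain Q l where Q: "orthogonal_matrix Q" "transpose X ** X = Q ** diag_mat l ** transpose Q"
    by (rule symmetric_diagonalizable)
  note o = orthogonal_matrix_cancel [OF Q(1)]
  have "0 < l $ k" for k
  proof -
    have "invertible Q"
      using o(1,2) unfolding invertible_def by blast
    then have "invertible (X ** Q)"
      by (rule invertible_mult [OF assms])
    then have "column k (X ** Q) \<noteq> 0"
      using invertible_det_nz [of "X ** Q"] det_zero_column(1) [of k "X ** Q"] by blast
    moreover have "diag_mat l = transpose (X ** Q) ** (X ** Q)"
    proof -
      have "diag_mat l = transpose Q ** (transpose X ** X) ** Q"
        by (simp add: Q(2) matrix_mul_assoc o)
      then show ?thesis by (simp add: matrix_transpose_mul matrix_mul_assoc)
    qed
    then have "diag_mat l $ k $ k = (transpose (X ** Q) ** (X ** Q)) $ k $ k"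
      by (rule arg_cong)
    then have "l $ k = (transpose (X ** Q) ** (X ** Q)) $ k $ k"
      by (simp add: diag_mat_def)
    then have "l $ k = column k (X ** Q) \<bullet> column k (X ** Q)"
      by (simp only: inner_columns)
    ultimately show ?thesis by simp
  qed
  with Q show ?thesis unfolding spd_def spectral_def by blast
qed

lemma spd_gram': "invertible (X :: real^'n^'n) \<Longrightarrow> spd (X ** transpose X)"
  using spd_gram [of "transpose X"] by (simp add: transpose_invertible)

section \<open>Continuity\<close>

text \<open>Eigenbases need not converge, but compactness of the orthogonal group gives a convergent
  subsequence. The eigenvalues, being the diagonal of \<open>transpose Q ** S ** Q\<close>, then
  converge along with it.\<close>

lemma spectral_subsequence:
  fixes S :: "nat \<Rightarrow> real^'n^'n"
  assumes spd: "\<And>n. spd (S n)" and lim: "S \<longlonglongrightarrow> S0" and spd0: "spd S0"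
  obtains r Q l Q0 l0 where "strict_mono (r :: nat \<Rightarrow> nat)" "\<And>n. spectral (S (r n)) (Q n) (l n)"
    "Q \<longlonglongrightarrow> Q0" "l \<longlonglongrightarrow> l0" "spectral S0 Q0 l0"
proof -
  obtain Q l where Ql: "\<And>n. spectral (S n) (Q n) (l n)"
    using spd unfolding spd_def by metis
  have "\<And>n. Q n \<in> {Q. orthogonal_matrix Q}"
    using Ql spectralD(1) by blast
  then obtain Q0 r where r: "strict_mono r" and Q0: "orthogonal_matrix Q0" and Qlim: "(Q \<circ> r) \<longlonglongrightarrow> Q0"
    using compact_orthogonal_matrices [unfolded compact_def, rule_format, of Q] by blast
  define D where "D = transpose Q0 ** S0 ** Q0"
  define l0 where "l0 = (\<chi> i. D $ i $ i)"
  have diag: "transpose (Q n) ** S n ** Q n = diag_mat (l n)" for n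
    using spectralD(3) [OF Ql [of n]]
    by (simp add: matrix_mul_assoc orthogonal_matrix_cancel [OF spectralD(1) [OF Ql [of n]]])
  have "(\<lambda>n. transpose ((Q \<circ> r) n) ** (S \<circ> r) n ** (Q \<circ> r) n) \<longlonglongrightarrow> D"
    unfolding D_def by (intro tendsto_intros Qlim LIMSEQ_subseq_LIMSEQ [OF lim r])
  then have Dlim: "(\<lambda>n. diag_mat (l (r n))) \<longlonglongrightarrow> D"
    by (simp add: diag)
  have entry: "(\<lambda>n. diag_mat (l (r n)) $ i $ j) \<longlonglongrightarrow> D $ i $ j" for i j
    by (intro tendsto_vec_nth Dlim)
  have "D = diag_mat l0"
    unfolding vec_eq_iff
  proof (intro allI)
    fix i j
    show "D $ i $ j = diag_mat l0 $ i $ j"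
    proof (cases "i = j")
      case False
      with entry [of i j] have "(\<lambda>n. 0) \<longlonglongrightarrow> D $ i $ j"
        by (simp add: diag_mat_def)
      then have "D $ i $ j = 0" by (simp add: LIMSEQ_const_iff)
      with False show ?thesis by (simp add: diag_mat_def)
    qed (simp add: diag_mat_def l0_def)
  qed
  moreover have "S0 = Q0 ** D ** transpose Q0"
    by (simp add: D_def matrix_mul_assoc orthogonal_matrix_cancel [OF Q0])
  ultimately have S0: "S0 = Q0 ** diag_mat l0 ** transpose Q0" by simp
  \<comment> \<open>Column \<open>i\<close> of the transition matrix to a positive diagonalisation
    of \<open>S0\<close> is a unit vector; a nonzero entry in it identifies \<open>l0 $ i\<close>
    with a positive eigenvalue.\<close>
  have "0 < l0 $ i" for i
  proof -
    obtain R m where R: "spectral S0 R m" using spd0 unfolding spd_def by blast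
    define W where "W = transpose R ** Q0"
    have "transpose W ** W = mat 1"
      by (simp add: W_def matrix_transpose_mul matrix_mul_assoc
          orthogonal_matrix_cancel [OF Q0] orthogonal_matrix_cancel [OF spectralD(1) [OF R]])
    then have "(transpose W ** W) $ i $ i = 1"
      by (simp add: mat_def)
    then have "column i W \<bullet> column i W = 1"
      by (simp only: inner_columns)
    then have "column i W \<noteq> 0" by auto
    then obtain j where "W $ j $ i \<noteq> 0"
      by (auto simp: column_def vec_eq_iff)
    then have "m $ j = l0 $ i"
      unfolding W_def using diagonalization_intertwine [OF Q0 S0 spectralD(1,3) [OF R]] by blast
    then show ?thesis using spectralD(2) [OF R, of j] by simp
  qed
  with S0 Q0 have "spectral S0 Q0 l0" by (simp add: spectral_def)
  moreover have "(l \<circ> r) \<longlonglongrightarrow> l0"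
  proof (rule vec_tendstoI)
    show "(\<lambda>n. (l \<circ> r) n $ i) \<longlonglongrightarrow> l0 $ i" for i
      using entry [of i i] by (simp add: l0_def diag_mat_def)
  qed
  ultimately show ?thesis
    using that [of r "Q \<circ> r" "l \<circ> r" Q0 l0] r Qlim Ql by simp
qed

section \<open>Joint continuity of double operator integrals\<close>

abbreviation poscont :: "(real \<Rightarrow> real \<Rightarrow> real) \<Rightarrow> bool" where
  "poscont \<phi> \<equiv> continuous_on ({0<..} \<times> {0<..}) (\<lambda>(x, y). \<phi> x y)"

lemma tendsto_schur:
  fixes l m :: "nat \<Rightarrow> real^'n"
  assumes \<phi>: "poscont \<phi>"
    and l: "l \<longlonglongrightarrow> l0" "\<And>n i. 0 < l n $ i" "\<And>i. 0 < l0 $ i"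
    and m: "m \<longlonglongrightarrow> m0" "\<And>n i. 0 < m n $ i" "\<And>i. 0 < m0 $ i"
    and M: "M \<longlonglongrightarrow> M0"
  shows "(\<lambda>n. schur \<phi> (l n) (m n) (M n)) \<longlonglongrightarrow> schur \<phi> l0 m0 M0"
proof -
  have "(\<lambda>n. \<phi> (l n $ i) (m n $ j)) \<longlonglongrightarrow> \<phi> (l0 $ i) (m0 $ j)" for i j
  proof -
    have "(\<lambda>n. (l n $ i, m n $ j)) \<longlonglongrightarrow> (l0 $ i, m0 $ j)"
      by (intro tendsto_intros l m)
    from continuous_on_tendsto_compose [OF \<phi> this] show ?thesis
      using l m by simp
  qed
  then show ?thesis
    unfolding schur_def by (intro vec_tendstoI) (auto intro!: tendsto_intros M)
qed

text \<open>If convergence failed, some subsequence would stay away from the limit. Along a further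
  subsequence the eigenbases of both \<open>S\<close> and \<open>T\<close> converge, so the formula
  of \<open>doi_eq\<close> passes to the limit. The limit is the same for every such subsequence
  since \<open>doi_eq\<close> holds in any eigenbases.\<close>

lemma tendsto_doi:
  fixes S T K :: "nat \<Rightarrow> real^'n^'n"
  assumes \<phi>: "poscont \<phi>"
    and S: "\<And>n. spd (S n)" "S \<longlonglongrightarrow> S0" "spd S0"
    and T: "\<And>n. spd (T n)" "T \<longlonglongrightarrow> T0" "spd T0" and K: "K \<longlonglongrightarrow> K0"
  shows "(\<lambda>n. doi \<phi> (S n) (T n) (K n)) \<longlonglongrightarrow> doi \<phi> S0 T0 K0"
proof (rule ccontr)
  assume "\<not> ?thesis"
  then obtain e where e: "e > 0"
    and "\<not> (\<forall>\<^sub>F n in sequentially. dist (doi \<phi> (S n) (T n) (K n)) (doi \<phi> S0 T0 K0) < e)"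
    unfolding tendsto_iff by blast
  then obtain a :: "nat \<Rightarrow> nat" where a: "strict_mono a"
    and far: "\<And>n. \<not> dist (doi \<phi> (S (a n)) (T (a n)) (K (a n))) (doi \<phi> S0 T0 K0) < e"
    using not_eventually_sequentiallyD [of "\<lambda>n. dist (doi \<phi> (S n) (T n) (K n)) (doi \<phi> S0 T0 K0) < e"]
    by blast
  obtain b Q l Q0 l0 where b: "strict_mono b" and Q: "\<And>n. spectral (S (a (b n))) (Q n) (l n)"
    and Q0: "Q \<longlonglongrightarrow> Q0" "l \<longlonglongrightarrow> l0" "spectral S0 Q0 l0"
    by (rule spectral_subsequence [OF S(1) LIMSEQ_subseq_LIMSEQ [OF S(2) a, unfolded o_def] S(3)], rule that)
  have ab: "strict_mono (a \<circ> b)" using a b strict_mono_o by blast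
  obtain c R m R0 m0 where c: "strict_mono c" and R: "\<And>n. spectral (T (a (b (c n)))) (R n) (m n)"
    and R0: "R \<longlonglongrightarrow> R0" "m \<longlonglongrightarrow> m0" "spectral T0 R0 m0"
    by (rule spectral_subsequence [OF T(1) LIMSEQ_subseq_LIMSEQ [OF T(2) ab, unfolded o_def] T(3)], rule that)
  have abc: "strict_mono (\<lambda>n. a (b (c n)))"
    using strict_mono_o [OF ab c] by (simp add: o_def)
  have Qc: "(\<lambda>n. Q (c n)) \<longlonglongrightarrow> Q0" and lc: "(\<lambda>n. l (c n)) \<longlonglongrightarrow> l0"
    using LIMSEQ_subseq_LIMSEQ [OF Q0(1) c] LIMSEQ_subseq_LIMSEQ [OF Q0(2) c] by (simp_all add: o_def)
  have Kc: "(\<lambda>n. K (a (b (c n)))) \<longlonglongrightarrow> K0"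
    using LIMSEQ_subseq_LIMSEQ [OF K abc] by (simp add: o_def)
  have "(\<lambda>n. transpose (Q (c n)) ** K (a (b (c n))) ** R n) \<longlonglongrightarrow> transpose Q0 ** K0 ** R0"
    by (intro tendsto_matrix_mult tendsto_transpose Qc Kc R0(1))
  then have "(\<lambda>n. schur \<phi> (l (c n)) (m n) (transpose (Q (c n)) ** K (a (b (c n))) ** R n))
      \<longlonglongrightarrow> schur \<phi> l0 m0 (transpose Q0 ** K0 ** R0)"
    by (rule tendsto_schur [OF \<phi> lc spectralD(2) [OF Q] spectralD(2) [OF Q0(3)]
          R0(2) spectralD(2) [OF R] spectralD(2) [OF R0(3)]])
  then have "(\<lambda>n. Q (c n) ** schur \<phi> (l (c n)) (m n) (transpose (Q (c n)) ** K (a (b (c n))) ** R n) ** transpose (R n))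
      \<longlonglongrightarrow> Q0 ** schur \<phi> l0 m0 (transpose Q0 ** K0 ** R0) ** transpose R0"
    by (intro tendsto_matrix_mult tendsto_transpose Qc R0(1))
  then have "(\<lambda>n. doi \<phi> (S (a (b (c n)))) (T (a (b (c n)))) (K (a (b (c n))))) \<longlonglongrightarrow> doi \<phi> S0 T0 K0"
    unfolding doi_eq [OF Q R] doi_eq [OF Q0(3) R0(3)] .
  then have "\<forall>\<^sub>F n in sequentially. dist (doi \<phi> (S (a (b (c n)))) (T (a (b (c n)))) (K (a (b (c n)))))
      (doi \<phi> S0 T0 K0) < e"
    by (rule tendstoD [OF _ e])
  then obtain n where "dist (doi \<phi> (S (a (b (c n)))) (T (a (b (c n)))) (K (a (b (c n))))) (doi \<phi> S0 T0 K0) < e"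
    unfolding eventually_sequentially by blast
  then show False
    by (rule notE [OF far])
qed

lemma continuous_on_doi [continuous_intros]:
  fixes f g k :: "'a::metric_space \<Rightarrow> real^'n^'n"
  assumes "poscont \<phi>" "continuous_on Z f" "continuous_on Z g" "continuous_on Z k"
    and "\<And>z. z \<in> Z \<Longrightarrow> spd (f z)" "\<And>z. z \<in> Z \<Longrightarrow> spd (g z)"
  shows "continuous_on Z (\<lambda>z. doi \<phi> (f z) (g z) (k z))"
  unfolding continuous_on_sequentially
proof (intro allI ballI impI)
  fix x a
  assume a: "a \<in> Z" and x: "(\<forall>n. x n \<in> Z) \<and> x \<longlonglongrightarrow> a"
  then have xn: "\<And>n. x n \<in> Z" by blast
  have lim: "(\<lambda>n. h (x n)) \<longlonglongrightarrow> h a" if "continuous_on Z h" for h :: "'a \<Rightarrow> real^'n^'n"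
    using that a x by (simp add: continuous_on_sequentially o_def)
  show "((\<lambda>z. doi \<phi> (f z) (g z) (k z)) \<circ> x) \<longlonglongrightarrow> doi \<phi> (f a) (g a) (k a)"
    unfolding o_def by (intro tendsto_doi assms lim a xn)
qed

lemma poscont_powr: "poscont (\<lambda>x y. x powr a * y powr b)"
  unfolding case_prod_beta by (intro continuous_intros) auto

text \<open>The power is the double operator integral of the identity matrix with symbol
  \<open>x powr a * y powr 0\<close>.\<close>

lemma continuous_on_mat_powr [continuous_intros]:
  fixes f :: "'a::metric_space \<Rightarrow> real^'n^'n"
  assumes "continuous_on Z f" "\<And>z. z \<in> Z \<Longrightarrow> spd (f z)"
  shows "continuous_on Z (\<lambda>z. mat_powr (f z) a)"
proof -
  have "continuous_on Z (\<lambda>z. doi (\<lambda>x y. x powr a * y powr 0) (f z) (f z) (mat 1))"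
    by (intro continuous_intros assms poscont_powr) auto
  moreover have "mat_powr (f z) 0 = mat 1" if z: "z \<in> Z" for z
  proof -
    obtain Q l where Q: "spectral (f z) Q l" using assms(2) [OF z] unfolding spd_def by blast
    \<comment> \<open>Since \<open>0 powr 0 = 0\<close>, nonzero eigenvalues are what makes the
      zeroth power the identity.\<close>
    have "l $ i \<noteq> 0" for i
      using spectralD(2) [OF Q, of i] by simp
    then have "diag_mat (\<chi> i. l $ i powr 0) = mat 1"
      by (simp add: diag_mat_def mat_def vec_eq_iff)
    then show ?thesis
      using orthogonal_matrix_cancel [OF spectralD(1) [OF Q]] by (simp add: mat_powr_spectral [OF Q])
  qed
  then have "doi (\<lambda>x y. x powr a * y powr 0) (f z) (f z) (mat 1) = mat_powr (f z) a" if "z \<in> Z" for z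
    unfolding doi_powr [OF assms(2) [OF that] assms(2) [OF that]] using that by simp
  ultimately show ?thesis
    by (rule continuous_on_eq)
qed

text \<open>The mean value theorem writes the divided difference as a derivative at an intermediate
  point; this controls it near the diagonal \<open>x = y\<close>.\<close>

lemma divdiff_mean_value:
  assumes "0 < x" "0 < y"
  shows "\<exists>\<xi>. min x y \<le> \<xi> \<and> \<xi> \<le> max x y \<and> divdiff a x y = a * \<xi> powr (a - 1)"
proof -
  have *: "\<exists>\<xi>. u \<le> \<xi> \<and> \<xi> \<le> v \<and> (v powr a - u powr a) / (v - u) = a * \<xi> powr (a - 1)"
    if "0 < u" "u < v" for u v
  proof -
    have "((\<lambda>x. x powr a) has_real_derivative a * z powr (a - 1)) (at z)" if "u \<le> z" for z
      using that \<open>0 < u\<close> by (intro has_real_derivative_powr) simp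
    then obtain z where z: "u < z" "z < v" "v powr a - u powr a = (v - u) * (a * z powr (a - 1))"
      using MVT2 [OF \<open>u < v\<close>, of "\<lambda>x. x powr a" "\<lambda>z. a * z powr (a - 1)"] by blast
    have "(v powr a - u powr a) / (v - u) = a * z powr (a - 1)"
      unfolding z(3) using \<open>u < v\<close> by simp
    with z show ?thesis by (intro exI [of _ z]) simp
  qed
  consider "x < y" | "y < x" | "x = y" by linarith
  then show ?thesis
  proof cases
    case 1
    then have "divdiff a x y = (y powr a - x powr a) / (y - x)"
      using minus_divide_divide [of "x powr a - y powr a" "x - y"] by (simp add: divdiff_def)
    with 1 * [of x y] assms show ?thesis by simp
  next
    case 2
    then have "divdiff a x y = (x powr a - y powr a) / (x - y)"
      by (simp add: divdiff_def)
    with 2 * [of y x] assms show ?thesis by simp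
  next
    case 3
    then show ?thesis by (intro exI [of _ x]) (simp add: divdiff_def)
  qed
qed

text \<open>At a diagonal point the intermediate points of \<open>divdiff_mean_value\<close> are
  squeezed between minimum and maximum of the coordinates, and the derivative is continuous.
  Elsewhere the quotient formula holds in a neighbourhood.\<close>

lemma poscont_divdiff: "poscont (divdiff a)"
  unfolding continuous_on_def
proof (intro ballI)
  fix p :: "real \<times> real"
  let ?Z = "{0<..} \<times> {0<..} :: (real \<times> real) set"
  assume p: "p \<in> ?Z"
  have f: "(fst \<longlongrightarrow> fst p) (at p within ?Z)" and s: "(snd \<longlongrightarrow> snd p) (at p within ?Z)"
    by (intro tendsto_intros)+
  show "((\<lambda>(x, y). divdiff a x y) \<longlongrightarrow> (case p of (x, y) \<Rightarrow> divdiff a x y)) (at p within ?Z)"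
  proof (cases "fst p = snd p")
    case True
    have "\<forall>z\<in>?Z. \<exists>\<xi>. min (fst z) (snd z) \<le> \<xi> \<and> \<xi> \<le> max (fst z) (snd z)
        \<and> divdiff a (fst z) (snd z) = a * \<xi> powr (a - 1)"
      using divdiff_mean_value by (simp add: mem_Times_iff)
    from bchoice [OF this] obtain \<xi> where \<xi>: "\<And>z. z \<in> ?Z \<Longrightarrow> min (fst z) (snd z) \<le> \<xi> z \<and> \<xi> z \<le> max (fst z) (snd z)
        \<and> divdiff a (fst z) (snd z) = a * \<xi> z powr (a - 1)"
      by blast
    have ev: "\<forall>\<^sub>F z in at p within ?Z. z \<in> ?Z"
      by (auto simp: eventually_at_filter)
    have "(\<xi> \<longlongrightarrow> fst p) (at p within ?Z)"
    proof (rule tendsto_sandwich)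
      show "\<forall>\<^sub>F z in at p within ?Z. min (fst z) (snd z) \<le> \<xi> z"
        and "\<forall>\<^sub>F z in at p within ?Z. \<xi> z \<le> max (fst z) (snd z)"
        using ev by (eventually_elim, use \<xi> in blast)+
      show "((\<lambda>z. min (fst z) (snd z)) \<longlongrightarrow> fst p) (at p within ?Z)"
        using tendsto_min [OF f s] True by simp
      show "((\<lambda>z. max (fst z) (snd z)) \<longlongrightarrow> fst p) (at p within ?Z)"
        using tendsto_max [OF f s] True by simp
    qed
    then have "((\<lambda>z. a * \<xi> z powr (a - 1)) \<longlongrightarrow> a * fst p powr (a - 1)) (at p within ?Z)"
      using p by (intro tendsto_intros) auto
    moreover have "\<forall>\<^sub>F z in at p within ?Z. a * \<xi> z powr (a - 1) = (\<lambda>(x, y). divdiff a x y) z"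
      using ev by eventually_elim (use \<xi> in \<open>auto simp: case_prod_beta\<close>)
    ultimately have "((\<lambda>(x, y). divdiff a x y) \<longlongrightarrow> a * fst p powr (a - 1)) (at p within ?Z)"
      by (rule Lim_transform_eventually)
    moreover have "(case p of (x, y) \<Rightarrow> divdiff a x y) = a * fst p powr (a - 1)"
      using True by (simp add: case_prod_beta divdiff_def)
    ultimately show ?thesis by (simp only:)
  next
    case False
    have "((\<lambda>z. (fst z powr a - snd z powr a) / (fst z - snd z)) \<longlongrightarrow>
        (fst p powr a - snd p powr a) / (fst p - snd p)) (at p within ?Z)"
      using p False by (intro tendsto_intros f s) auto
    moreover have "((\<lambda>z. fst z - snd z) \<longlongrightarrow> fst p - snd p) (at p within ?Z)"
      by (intro tendsto_intros)
    then have "\<forall>\<^sub>F z in at p within ?Z. fst z - snd z \<noteq> 0"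
      using False by (intro tendsto_imp_eventually_ne) auto
    then have "\<forall>\<^sub>F z in at p within ?Z.
        (fst z powr a - snd z powr a) / (fst z - snd z) = (\<lambda>(x, y). divdiff a x y) z"
      by eventually_elim (auto simp: divdiff_def case_prod_beta)
    ultimately have "((\<lambda>(x, y). divdiff a x y) \<longlongrightarrow> (fst p powr a - snd p powr a) / (fst p - snd p))
        (at p within ?Z)"
      by (rule Lim_transform_eventually)
    moreover have "(case p of (x, y) \<Rightarrow> divdiff a x y) = (fst p powr a - snd p powr a) / (fst p - snd p)"
      using False by (simp add: case_prod_beta divdiff_def)
    ultimately show ?thesis by (simp only:)
  qed
qed

section \<open>The metric and its derivative\<close>

lemma divdiff_commute: "divdiff a x y = divdiff a y x"
  using minus_divide_divide [of "x powr a - y powr a" "x - y"] by (simp add: divdiff_def)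

lemma transpose_mat_powr:
  assumes "spd S"
  shows "transpose (mat_powr S a) = mat_powr S a"
proof -
  obtain Q l where "spectral S Q l" using assms unfolding spd_def by blast
  moreover have "transpose (diag_mat m) = diag_mat m" for m :: "real^'a"
    by (auto simp: transpose_def diag_mat_def vec_eq_iff)
  ultimately show ?thesis
    by (simp add: mat_powr_spectral matrix_transpose_mul matrix_mul_assoc)
qed

lemma transpose_doi:
  assumes "spd S" "spd T"
  shows "transpose (doi \<phi> S T K) = doi (\<lambda>x y. \<phi> y x) T S (transpose K)"
proof -
  obtain Q l R m where *: "spectral S Q l" "spectral T R m" using assms unfolding spd_def by blast
  have "transpose (schur \<phi> l m M) = schur (\<lambda>x y. \<phi> y x) m l (transpose M)" for M
    by (simp add: schur_def transpose_def vec_eq_iff)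
  then show ?thesis
    by (simp add: doi_eq [OF *] doi_eq [OF *(2,1)] matrix_transpose_mul matrix_mul_assoc)
qed

section \<open>The operator \<open>A_op\<close>, its inverse and its dependence on the base
  point\<close>

abbreviation lpow :: "nat \<Rightarrow> nat \<Rightarrow> real" where
  "lpow N p \<equiv> (real N - real p) / real N"

abbreviation rpow :: "nat \<Rightarrow> nat \<Rightarrow> real" where
  "rpow N p \<equiv> (real p - 1) / real N"

definition A_symbol :: "nat \<Rightarrow> real \<Rightarrow> real \<Rightarrow> real" where
  "A_symbol N x y = (\<Sum>p = 1..N. x powr lpow N p * y powr rpow N p)"

text \<open>The inverse is given by the reciprocal symbol rather than by \<open>inv\<close>, so that
  its continuity in \<open>X\<close> is that of a double operator integral.\<close>

definition A_inv :: "nat \<Rightarrow> real^'n^'n \<Rightarrow> real^'n^'n \<Rightarrow> real^'n^'n" where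
  "A_inv N X Z = doi (\<lambda>x y. 1 / A_symbol N x y) (X ** transpose X) (transpose X ** X) Z"

lemma A_symbol_pos: "N \<ge> 1 \<Longrightarrow> x > 0 \<Longrightarrow> y > 0 \<Longrightarrow> A_symbol N x y > 0"
  unfolding A_symbol_def by (intro sum_pos) auto

lemma poscont_A_symbol: "poscont (A_symbol N)"
  unfolding A_symbol_def case_prod_beta by (intro continuous_intros) auto

lemma poscont_inverse_A_symbol:
  assumes "N \<ge> 1"
  shows "poscont (\<lambda>x y. 1 / A_symbol N x y)"
proof -
  have "A_symbol N (fst z) (snd z) \<noteq> 0" if "z \<in> {0<..} \<times> {0<..}" for z
    using A_symbol_pos [OF assms, of "fst z" "snd z"] that by (simp add: mem_Times_iff)
  then show ?thesis
    using poscont_A_symbol [of N] unfolding case_prod_beta by (intro continuous_intros) auto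
qed

lemma A_op_doi:
  assumes "invertible X"
  shows "A_op N X Z = doi (A_symbol N) (X ** transpose X) (transpose X ** X) Z"
  unfolding A_op_def A_symbol_def
  by (simp only: doi_sum [OF spd_gram' spd_gram, OF assms assms] doi_powr [OF spd_gram' spd_gram, OF assms assms])

lemma A_op_self_adjoint:
  "invertible X \<Longrightarrow> Y \<bullet> A_op N X Z = A_op N X Y \<bullet> Z"
  unfolding A_op_doi by (rule doi_self_adjoint [OF spd_gram' spd_gram])

lemma A_op_A_inv:
  assumes "N \<ge> 1" "invertible X"
  shows "A_op N X (A_inv N X Z) = Z" "A_inv N X (A_op N X Z) = Z"
proof -
  note spd = spd_gram' [OF assms(2)] spd_gram [OF assms(2)]
  have "x > 0 \<Longrightarrow> y > 0 \<Longrightarrow> A_symbol N x y \<noteq> 0" for x y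
    using A_symbol_pos [OF assms(1), of x y] by simp
  then have "doi (\<lambda>x y. A_symbol N x y * (1 / A_symbol N x y)) (X ** transpose X) (transpose X ** X) Z = Z"
    "doi (\<lambda>x y. 1 / A_symbol N x y * A_symbol N x y) (X ** transpose X) (transpose X ** X) Z = Z"
    by (subst (2) doi_one [OF spd, symmetric], intro doi_cong [OF spd], simp)+
  then show "A_op N X (A_inv N X Z) = Z" "A_inv N X (A_op N X Z) = Z"
    unfolding A_op_doi [OF assms(2)] A_inv_def doi_doi [OF spd] .
qed

text \<open>A two-sided inverse determines the function \<open>inv\<close>, which replaces the
  abstract inverse in the metric by \<open>A_inv\<close>.\<close>

lemma g_metric_eq:
  assumes "N \<ge> 1" "invertible X"
  shows "g_metric N X Z W = Z \<bullet> A_inv N X W"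
proof -
  have "inv (A_op N X) W = A_inv N X W"
    using A_op_A_inv [OF assms] by (metis inv_equality)
  then show ?thesis by (simp add: g_metric_def trace_transpose_mult)
qed

lemma continuous_on_A_op [continuous_intros]:
  fixes f k :: "'a::metric_space \<Rightarrow> real^'n^'n"
  assumes "continuous_on Z f" "continuous_on Z k" "\<And>z. z \<in> Z \<Longrightarrow> invertible (f z)"
  shows "continuous_on Z (\<lambda>z. A_op N (f z) (k z))"
  unfolding A_op_def by (intro continuous_intros assms spd_gram' spd_gram)

lemma continuous_on_A_inv [continuous_intros]:
  fixes f k :: "'a::metric_space \<Rightarrow> real^'n^'n"
  assumes "N \<ge> 1" "continuous_on Z f" "continuous_on Z k" "\<And>z. z \<in> Z \<Longrightarrow> invertible (f z)"
  shows "continuous_on Z (\<lambda>z. A_inv N (f z) (k z))"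
  unfolding A_inv_def by (intro continuous_intros assms poscont_inverse_A_symbol spd_gram' spd_gram)

text \<open>A difference quotient of \<open>A_op\<close> between the base points \<open>X\<close>
  and \<open>Y\<close>. The quotients \<open>K\<close> and \<open>L\<close> of the Gram increments
  are separate arguments, so that the expression remains defined and continuous at
  \<open>Y = X\<close>, where it becomes a derivative.\<close>

definition A_slope ::
  "nat \<Rightarrow> real^'n^'n \<Rightarrow> real^'n^'n \<Rightarrow> real^'n^'n \<Rightarrow> real^'n^'n \<Rightarrow> real^'n^'n \<Rightarrow> real^'n^'n" where
  "A_slope N X Y K L Z = (\<Sum>p = 1..N.
      doi (divdiff (lpow N p)) (Y ** transpose Y) (X ** transpose X) K ** Z **
        mat_powr (transpose Y ** Y) (rpow N p)
    + mat_powr (X ** transpose X) (lpow N p) ** Z **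
        doi (divdiff (rpow N p)) (transpose Y ** Y) (transpose X ** X) L)"

text \<open>The discrete product rule \<open>a' Z b' - a Z b = (a' - a) Z b' + a Z (b' - b)\<close>
  in each summand, with the differences of powers given by \<open>mat_powr_diff\<close>.\<close>

lemma A_op_diff:
  assumes X: "invertible X" and Y: "invertible Y"
    and K: "Y ** transpose Y - X ** transpose X = r *\<^sub>R K"
    and L: "transpose Y ** Y - transpose X ** X = r *\<^sub>R L"
  shows "A_op N Y Z - A_op N X Z = r *\<^sub>R A_slope N X Y K L Z"
proof -
  have 1: "r *\<^sub>R doi (divdiff a) (Y ** transpose Y) (X ** transpose X) K
      = mat_powr (Y ** transpose Y) a - mat_powr (X ** transpose X) a" for a
    using mat_powr_diff [OF spd_gram' [OF Y] spd_gram' [OF X]]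
    by (simp add: K doi_scaleR [OF spd_gram' [OF Y] spd_gram' [OF X]])
  have 2: "r *\<^sub>R doi (divdiff a) (transpose Y ** Y) (transpose X ** X) L
      = mat_powr (transpose Y ** Y) a - mat_powr (transpose X ** X) a" for a
    using mat_powr_diff [OF spd_gram [OF Y] spd_gram [OF X]]
    by (simp add: L doi_scaleR [OF spd_gram [OF Y] spd_gram [OF X]])
  have "r *\<^sub>R A_slope N X Y K L Z = (\<Sum>p = 1..N.
      (r *\<^sub>R doi (divdiff (lpow N p)) (Y ** transpose Y) (X ** transpose X) K) ** Z **
        mat_powr (transpose Y ** Y) (rpow N p)
    + mat_powr (X ** transpose X) (lpow N p) ** Z **
        (r *\<^sub>R doi (divdiff (rpow N p)) (transpose Y ** Y) (transpose X ** X) L))"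
    unfolding A_slope_def scaleR_sum_right scaleR_add_right
    by (simp only: matrix_mult_scaleR_left matrix_mult_scaleR_right)
  also have "\<dots> = A_op N Y Z - A_op N X Z"
    unfolding 1 2 A_op_def sum_subtractf [symmetric]
    by (rule sum.cong) (simp_all add: matrix_mult_diff_left matrix_mult_diff_right)
  finally show ?thesis ..
qed

text \<open>The last two arguments of \<open>A_slope\<close> are the derivatives of
  \<open>X ** transpose X\<close> and \<open>transpose X ** X\<close> in direction
  \<open>H\<close>.\<close>

abbreviation A_deriv :: "nat \<Rightarrow> real^'n^'n \<Rightarrow> real^'n^'n \<Rightarrow> real^'n^'n \<Rightarrow> real^'n^'n" where
  "A_deriv N X H \<equiv> A_slope N X X (H ** transpose X + X ** transpose H) (transpose H ** X + transpose X ** H)"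

lemma continuous_on_A_slope [continuous_intros]:
  fixes x y k l z :: "'a::metric_space \<Rightarrow> real^'n^'n"
  assumes "continuous_on Z x" "continuous_on Z y" "continuous_on Z k" "continuous_on Z l"
    "continuous_on Z z" "\<And>w. w \<in> Z \<Longrightarrow> invertible (x w)" "\<And>w. w \<in> Z \<Longrightarrow> invertible (y w)"
  shows "continuous_on Z (\<lambda>w. A_slope N (x w) (y w) (k w) (l w) (z w))"
  unfolding A_slope_def by (intro continuous_intros assms poscont_divdiff spd_gram' spd_gram)

lemma gram_diff:
  fixes Z H :: "real^'n^'n"
  shows "(Z + r *\<^sub>R H) ** transpose (Z + r *\<^sub>R H) - Z ** transpose Z
      = r *\<^sub>R (H ** transpose Z + Z ** transpose H + r *\<^sub>R (H ** transpose H))"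
    and "transpose (Z + r *\<^sub>R H) ** (Z + r *\<^sub>R H) - transpose Z ** Z
      = r *\<^sub>R (transpose H ** Z + transpose Z ** H + r *\<^sub>R (transpose H ** H))"
  by (simp_all add: transpose_add transpose_scaleR matrix_mult_add_left matrix_mult_add_right
      matrix_mult_scaleR_left matrix_mult_scaleR_right scaleR_right_distrib add_ac)

text \<open>With \<open>P = A\<inverse> y\<close>, self-adjointness of \<open>A\<close> gives
  \<open>\<langle>y', P'\<rangle> - \<langle>y, P\<rangle> = \<langle>y' - y, P'\<rangle> + \<langle>P, y' - y\<rangle> - \<langle>P, (A' - A) P'\<rangle>\<close>,
  so that the difference quotient of the squared norm has a continuous extension.\<close>
lemma has_derivative_squared_norm:
  fixes x y h k :: "real^'n^'n" and N :: nat
  defines "P \<equiv> \<lambda>s. A_inv N (x + s *\<^sub>R h) (y + s *\<^sub>R k)"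
  assumes N: "N \<ge> 1" and U: "\<And>s. s \<in> U \<Longrightarrow> invertible (x + s *\<^sub>R h)" and s: "s \<in> U"
  shows "((\<lambda>s. (y + s *\<^sub>R k) \<bullet> P s) has_real_derivative
      2 * (k \<bullet> P s) - P s \<bullet> A_deriv N (x + s *\<^sub>R h) h (P s)) (at s within U)"
proof -
  define xs where "xs u = x + u *\<^sub>R h" for u
  define K where "K u = h ** transpose (xs s) + xs s ** transpose h + (u - s) *\<^sub>R (h ** transpose h)" for u
  define L where "L u = transpose h ** xs s + transpose (xs s) ** h + (u - s) *\<^sub>R (transpose h ** h)" for u
  \<comment> \<open>For \<open>u \<noteq> s\<close> this is the difference quotient, with
    \<open>K\<close> and \<open>L\<close> the Gram increments divided by \<open>u - s\<close>. At
    \<open>u = s\<close> it is the claimed derivative.\<close>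
  define q where "q u = k \<bullet> P u + P s \<bullet> k - P s \<bullet> A_slope N (xs s) (xs u) (K u) (L u) (P u)" for u
  have inv: "invertible (xs u)" if "u \<in> U" for u
    using U [OF that] by (simp add: xs_def)
  have AP: "A_op N (xs u) (P u) = y + u *\<^sub>R k" if "u \<in> U" for u
    unfolding P_def xs_def by (rule A_op_A_inv [OF N U [OF that]])
  have contP: "continuous_on U P"
    unfolding P_def by (intro continuous_intros N U)
  have xs: "continuous_on U xs" unfolding xs_def by (intro continuous_intros)
  have "continuous_on U q"
    unfolding q_def K_def L_def by (intro continuous_intros contP inv s xs)
  then have lim: "(q \<longlongrightarrow> q s) (at s within U)"
    using s by (simp add: continuous_on_def)
  have eq: "q u = ((y + u *\<^sub>R k) \<bullet> P u - (y + s *\<^sub>R k) \<bullet> P s) / (u - s)" if u: "u \<in> U" "u \<noteq> s" for u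
  proof -
    have xu: "xs u = xs s + (u - s) *\<^sub>R h"
      by (simp add: xs_def scaleR_left_diff_distrib)
    have "A_op N (xs u) (P u) - A_op N (xs s) (P u)
        = (u - s) *\<^sub>R A_slope N (xs s) (xs u) (K u) (L u) (P u)"
      by (rule A_op_diff [OF inv [OF s] inv [OF u(1)]])
        (unfold xu K_def L_def, rule gram_diff, rule gram_diff)
    then have "(u - s) * (P s \<bullet> A_slope N (xs s) (xs u) (K u) (L u) (P u))
        = P s \<bullet> (y + u *\<^sub>R k) - A_op N (xs s) (P s) \<bullet> P u"
      by (metis AP [OF u(1)] A_op_self_adjoint [OF inv [OF s]] inner_diff_right inner_scaleR_right)
    then have "(u - s) * q u = (y + u *\<^sub>R k) \<bullet> P u - (y + s *\<^sub>R k) \<bullet> P s"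
      unfolding AP [OF s] q_def
      by (simp add: algebra_simps inner_add_left inner_add_right inner_commute)
    with u show ?thesis by (simp add: field_simps)
  qed
  have "((\<lambda>s. (y + s *\<^sub>R k) \<bullet> P s) has_real_derivative q s) (at s within U)"
    unfolding has_field_derivative_iff
    by (rule Lim_transform_eventually [OF lim]) (auto simp: eventually_at_filter eq)
  moreover have "q s = 2 * (k \<bullet> P s) - P s \<bullet> A_deriv N (x + s *\<^sub>R h) h (P s)"
    by (simp add: q_def K_def L_def xs_def inner_commute)
  ultimately show ?thesis by simp
qed

text \<open>Written without singular vectors, so that it is continuous along continuous
  \<open>X\<close> and \<open>P\<close> although the decompositions chosen at each time need not
  depend continuously on time.\<close>

definition half_grad :: "nat \<Rightarrow> real^'n^'n \<Rightarrow> real^'n^'n \<Rightarrow> real^'n^'n" where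
  "half_grad N X P = (\<Sum>p = 1..N.
      doi (divdiff (lpow N p)) (X ** transpose X) (X ** transpose X)
        (P ** mat_powr (transpose X ** X) (rpow N p) ** transpose P) ** X
    + X ** doi (divdiff (rpow N p)) (transpose X ** X) (transpose X ** X)
        (transpose P ** mat_powr (X ** transpose X) (lpow N p) ** P))"

lemma continuous_on_half_grad [continuous_intros]:
  fixes x z :: "'a::metric_space \<Rightarrow> real^'n^'n"
  assumes "continuous_on Z x" "continuous_on Z z" "\<And>w. w \<in> Z \<Longrightarrow> invertible (x w)"
  shows "continuous_on Z (\<lambda>w. half_grad N (x w) (z w))"
  unfolding half_grad_def by (intro continuous_intros assms poscont_divdiff spd_gram' spd_gram)

text \<open>Adjoints of products and of \<open>doi\<close> move everything except \<open>H\<close>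
  to the other side. Symmetry of \<open>divdiff\<close> keeps the resulting matrices symmetric, so
  \<open>inner_symmetrized\<close> applies and yields the factor 2.\<close>

lemma inner_A_deriv:
  fixes X P H :: "real^'n^'n"
  assumes "invertible X"
  shows "P \<bullet> A_deriv N X H P = 2 * (H \<bullet> half_grad N X P)"
proof -
  let ?S = "X ** transpose X" and ?T = "transpose X ** X"
  let ?K = "H ** transpose X + X ** transpose H" and ?L = "transpose H ** X + transpose X ** H"
  note S = spd_gram' [OF assms] and T = spd_gram [OF assms]
  have sym: "transpose (doi (divdiff a) R R M) = doi (divdiff a) R R M"
    if "spd R" "transpose M = M" for a and R M :: "real^'n^'n"
    unfolding transpose_doi [OF that(1,1)] that(2) by (subst divdiff_commute) (rule refl)
  have 1: "P \<bullet> (doi (divdiff a) ?S ?S ?K ** P ** mat_powr ?T b)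
      = 2 * (H \<bullet> (doi (divdiff a) ?S ?S (P ** mat_powr ?T b ** transpose P) ** X))" for a b
  proof -
    have "P \<bullet> (doi (divdiff a) ?S ?S ?K ** P ** mat_powr ?T b)
        = (doi (divdiff a) ?S ?S ?K ** (P ** mat_powr ?T b)) \<bullet> P"
      by (simp add: inner_commute matrix_mul_assoc)
    also have "\<dots> = doi (divdiff a) ?S ?S ?K \<bullet> (P ** mat_powr ?T b ** transpose P)"
      by (simp add: inner_matrix_mult_right matrix_transpose_mul transpose_mat_powr [OF T] matrix_mul_assoc)
    also have "\<dots> = ?K \<bullet> doi (divdiff a) ?S ?S (P ** mat_powr ?T b ** transpose P)"
      by (rule doi_self_adjoint [OF S S, symmetric])
    also have "\<dots> = 2 * (H \<bullet> (doi (divdiff a) ?S ?S (P ** mat_powr ?T b ** transpose P) ** X))"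
      by (rule inner_symmetrized, rule sym [OF S])
        (simp add: matrix_transpose_mul transpose_mat_powr [OF T] matrix_mul_assoc)
    finally show ?thesis .
  qed
  have 2: "P \<bullet> (mat_powr ?S a ** P ** doi (divdiff b) ?T ?T ?L)
      = 2 * (H \<bullet> (X ** doi (divdiff b) ?T ?T (transpose P ** mat_powr ?S a ** P)))" for a b
  proof -
    have "P \<bullet> (mat_powr ?S a ** P ** doi (divdiff b) ?T ?T ?L)
        = (mat_powr ?S a ** P ** doi (divdiff b) ?T ?T ?L) \<bullet> P"
      by (rule inner_commute)
    also have "\<dots> = doi (divdiff b) ?T ?T ?L \<bullet> (transpose P ** mat_powr ?S a ** P)"
      by (simp add: inner_matrix_mult_left matrix_transpose_mul transpose_mat_powr [OF S] matrix_mul_assoc)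
    also have "\<dots> = ?L \<bullet> doi (divdiff b) ?T ?T (transpose P ** mat_powr ?S a ** P)"
      by (rule doi_self_adjoint [OF T T, symmetric])
    also have "\<dots> = 2 * (H \<bullet> (X ** doi (divdiff b) ?T ?T (transpose P ** mat_powr ?S a ** P)))"
      by (rule inner_symmetrized, rule sym [OF T])
        (simp add: matrix_transpose_mul transpose_mat_powr [OF S] matrix_mul_assoc)
    finally show ?thesis .
  qed
  show ?thesis
    unfolding A_slope_def half_grad_def inner_sum_right inner_add_right 1 2 sum_distrib_left
    by (simp add: algebra_simps)
qed

text \<open>\<open>U\<close> and \<open>V\<close> are eigenbases of the two Gram matrices, both with
  the squared singular values as eigenvalues. The double operator integrals thus become Hadamard
  products with \<open>f1\<close>.\<close>

lemma half_grad_svd: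
  fixes X P U S V :: "real^'n^'n"
  assumes "is_svd X U S V"
  shows "half_grad N X P = U ** (\<Sum>p = 1..N.
      hadamard (f1 (lpow N p) (S ** S)) (M1 N p U S V P) ** S
    + S ** hadamard (f1 (rpow N p) (S ** S)) (M2 N p U S V P)) ** transpose V"
proof -
  define s where "s = (\<chi> i. S $ i $ i)"
  define l where "l = (\<chi> i. S $ i $ i * S $ i $ i)"
  have U: "orthogonal_matrix U" and V: "orthogonal_matrix V" and pos: "\<And>i. 0 < S $ i $ i"
    and X: "X = U ** S ** transpose V" and off: "\<And>i j. i \<noteq> j \<Longrightarrow> S $ i $ j = 0"
    using assms by (auto simp: is_svd_def)
  note oU = orthogonal_matrix_cancel [OF U] and oV = orthogonal_matrix_cancel [OF V]
  have Sd: "S = diag_mat s"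
    using off by (auto simp: s_def diag_mat_def vec_eq_iff)
  have St: "transpose S = S"
    using off by (simp add: transpose_def vec_eq_iff) metis
  have SS: "S ** S = diag_mat l"
  proof -
    have "diag_mat s ** diag_mat s = diag_mat l"
      unfolding vec_eq_iff diag_mat_mult_left by (simp add: s_def l_def diag_mat_def)
    then show ?thesis by (simp flip: Sd)
  qed
  have "X ** transpose X = U ** (S ** S) ** transpose U"
    by (simp add: X matrix_transpose_mul matrix_mul_assoc oV St)
  then have sU: "spectral (X ** transpose X) U l"
    using U pos by (simp add: SS spectral_def l_def)
  have "transpose X ** X = V ** (S ** S) ** transpose V"
    by (simp add: X matrix_transpose_mul matrix_mul_assoc oU St)
  then have sV: "spectral (transpose X ** X) V l"
    using V pos by (simp add: SS spectral_def l_def)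
  have sS: "spectral S (mat 1) s"
    unfolding spectral_def
  proof (intro conjI allI)
    show "0 < s $ i" for i using pos by (simp add: s_def)
    show "S = mat 1 ** diag_mat s ** transpose (mat 1)" by (simp flip: Sd)
  qed (rule orthogonal_matrix_id)
  \<comment> \<open>Exponents double because \<open>M1\<close> and \<open>M2\<close> take powers of
    \<open>S\<close>, whereas the eigenvalues \<open>l\<close> are squares.\<close>
  have pw: "diag_mat (\<chi> i. l $ i powr b) = mat_powr S c" if "c = 2 * b" for b c
  proof -
    have "l $ i powr b = s $ i powr c" for i
      using pos [of i] by (simp add: that l_def s_def powr_mult flip: powr_add)
    then show ?thesis by (simp add: mat_powr_spectral [OF sS])
  qed
  have sch: "schur (divdiff a) l l M = hadamard (f1 a (S ** S)) M" for a M
    by (simp add: schur_def hadamard_def f1_def divdiff_def SS vec_eq_iff diag_mat_def)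
  have 1: "doi (divdiff a) (X ** transpose X) (X ** transpose X)
        (P ** mat_powr (transpose X ** X) (rpow N p) ** transpose P) ** X
      = U ** (hadamard (f1 a (S ** S)) (M1 N p U S V P) ** S) ** transpose V" for a p
    by (simp add: doi_eq [OF sU sU] mat_powr_spectral [OF sV] sch M1_def Let_def
        pw [of "2 * (real p - 1) / real N"] matrix_transpose_mul matrix_mul_assoc)
      (simp add: X matrix_mul_assoc oU)
  have 2: "X ** doi (divdiff a) (transpose X ** X) (transpose X ** X)
        (transpose P ** mat_powr (X ** transpose X) (lpow N p) ** P)
      = U ** (S ** hadamard (f1 a (S ** S)) (M2 N p U S V P)) ** transpose V" for a p
    by (simp add: doi_eq [OF sV sV] mat_powr_spectral [OF sU] sch M2_def Let_def
        pw [of "2 * (real N - real p) / real N"] matrix_transpose_mul matrix_mul_assoc)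
      (simp add: X matrix_mul_assoc oV)
  show ?thesis
    unfolding half_grad_def 1 2
    by (simp only: matrix_mult_sum_left matrix_mult_sum_right matrix_mult_add_left matrix_mult_add_right)
qed

section \<open>The first variation of the action\<close>

lemma continuous_on_det [continuous_intros]:
  fixes f :: "'a::topological_space \<Rightarrow> real^'n^'n"
  shows "continuous_on Z f \<Longrightarrow> continuous_on Z (\<lambda>z. det (f z))"
  unfolding det_def by (intro continuous_intros)

lemma continuous_on_snd_compose:
  "continuous_on T f \<Longrightarrow> continuous_on (U \<times> T) (\<lambda>z. f (snd z))"
  by (rule continuous_on_compose2 [where g = f]) (auto intro: continuous_on_snd continuous_on_id)

text \<open>The zeros of the determinant on a compact rectangle form a compact set, so the
  parameters \<open>s\<close> at which one occurs form a closed set. It misses 0, hence a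
  neighbourhood of 0.\<close>

lemma invertible_perturbed_path:
  fixes X h :: "real \<Rightarrow> real^'n^'n"
  assumes X: "continuous_on {0..1} X" and h: "continuous_on {0..1} h"
    and inv: "\<And>t. t \<in> {0..1} \<Longrightarrow> invertible (X t)"
  obtains e where "e > 0" "\<And>s t. s \<in> {-e..e} \<Longrightarrow> t \<in> {0..1} \<Longrightarrow> invertible (X t + s *\<^sub>R h t)"
proof -
  let ?D = "{-1..1} \<times> {0..1} :: (real \<times> real) set"
  let ?f = "\<lambda>z. det (X (snd z) + fst z *\<^sub>R h (snd z))"
  define Z where "Z = ?D \<inter> ?f -` {0}"
  have D: "compact ?D" by (intro compact_Times compact_Icc)
  have "continuous_on ?D ?f"
    by (intro continuous_intros continuous_on_snd_compose X h)
  then have "closed Z"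
    unfolding Z_def using D by (intro continuous_closed_preimage) (auto intro: compact_imp_closed)
  then have "compact (?D \<inter> Z)" using D by (rule compact_Int_closed [rotated])
  then have "compact Z" by (simp add: Z_def Int_assoc [symmetric])
  then have "closed (fst ` Z)"
    by (intro compact_imp_closed compact_continuous_image continuous_intros)
  then have "open (- (fst ` Z))" by (rule open_Compl)
  moreover have "0 \<in> - (fst ` Z)"
    using inv by (auto simp: Z_def invertible_det_nz)
  ultimately obtain d where d: "d > 0" "ball 0 d \<subseteq> - (fst ` Z)"
    using open_contains_ball by blast
  show ?thesis
  proof
    \<comment> \<open>Halving \<open>d\<close> puts the closed interval inside the open ball; the
      bound 1 keeps \<open>s\<close> in the rectangle.\<close>
    show "min (d / 2) 1 > 0" using d by simp
    fix s t :: real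
    assume s: "s \<in> {- min (d / 2) 1..min (d / 2) 1}" and t: "t \<in> {0..1}"
    then have "s \<in> ball 0 d" using d(1) by (auto simp: dist_real_def)
    then have "s \<notin> fst ` Z" using d(2) by blast
    then have "(s, t) \<notin> Z" by (metis fst_conv imageI)
    moreover have "(s, t) \<in> ?D" using s t by (auto simp: min_def split: if_splits)
    ultimately have "?f (s, t) \<noteq> 0" unfolding Z_def by blast
    then show "invertible (X t + s *\<^sub>R h t)"
      by (simp add: invertible_det_nz)
  qed
qed

text \<open>Differentiation under the integral sign, justified by joint continuity of the derivative
  in \<open>s\<close> and \<open>t\<close>. \<open>P\<close> enters through
  \<open>A_op N (X t) (P t) = X' t\<close>, which fits both a \<open>P\<close> built from a geodesic
  and one given by the system.\<close>

lemma first_variation: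
  fixes X X' h h' :: "real \<Rightarrow> real^'n^'n"
  assumes N: "N \<ge> 1" and X': "continuous_on {0..1} X'" and h': "continuous_on {0..1} h'"
    and dX: "\<And>t. t \<in> {0..1} \<Longrightarrow> (X has_vector_derivative X' t) (at t within {0..1})"
    and dh: "\<And>t. t \<in> {0..1} \<Longrightarrow> (h has_vector_derivative h' t) (at t within {0..1})"
    and inv: "\<And>t. t \<in> {0..1} \<Longrightarrow> invertible (X t)"
    and P: "\<And>t. t \<in> {0..1} \<Longrightarrow> A_op N (X t) (P t) = X' t"
  shows "((\<lambda>s. action (g_metric N) (\<lambda>t. X t + s *\<^sub>R h t)) has_real_derivative
      2 * integral {0..1} (\<lambda>t. h' t \<bullet> P t - h t \<bullet> half_grad N (X t) (P t))) (at 0)"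
proof -
  have cX: "continuous_on {0..1} X" and ch: "continuous_on {0..1} h"
    using dX dh by (meson continuous_on_vector_derivative)+
  obtain e where e: "e > 0"
    and inve: "\<And>s t. s \<in> {-e..e} \<Longrightarrow> t \<in> {0..1} \<Longrightarrow> invertible (X t + s *\<^sub>R h t)"
    using invertible_perturbed_path [OF cX ch inv] by blast
  define U where "U = {-e..e}"
  define Q where "Q s t = A_inv N (X t + s *\<^sub>R h t) (X' t + s *\<^sub>R h' t)" for s t
  define f where "f s t = (X' t + s *\<^sub>R h' t) \<bullet> Q s t" for s t
  define fs where "fs s t = 2 * (h' t \<bullet> Q s t) - Q s t \<bullet> A_deriv N (X t + s *\<^sub>R h t) (h t) (Q s t)" for s t
  have invU: "invertible (X t + s *\<^sub>R h t)" if "s \<in> U" "t \<in> {0..1}" for s t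
    using inve that by (simp add: U_def)
  have act: "action (g_metric N) (\<lambda>t. X t + s *\<^sub>R h t) = integral (cbox 0 1) (f s)" if s: "s \<in> U" for s
    unfolding action_def cbox_interval
  proof (rule Henstock_Kurzweil_Integration.integral_cong)
    fix t :: real assume t: "t \<in> {0..1}"
    have "((\<lambda>t. X t + s *\<^sub>R h t) has_vector_derivative X' t + s *\<^sub>R h' t) (at t within {0..1})"
      using dX [OF t] dh [OF t] by (auto intro!: derivative_eq_intros)
    then have "vector_derivative (\<lambda>t. X t + s *\<^sub>R h t) (at t within {0..1}) = X' t + s *\<^sub>R h' t"
      using t vector_derivative_within_cbox [of 0 1] by (simp add: cbox_interval)
    then show "g_metric N (X t + s *\<^sub>R h t)
        (vector_derivative (\<lambda>t. X t + s *\<^sub>R h t) (at t within {0..1}))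
        (vector_derivative (\<lambda>t. X t + s *\<^sub>R h t) (at t within {0..1})) = f s t"
      by (simp add: g_metric_eq [OF N invU [OF s t]] f_def Q_def)
  qed
  have c2: "continuous_on (U \<times> {0..1}) (\<lambda>z. Q (fst z) (snd z))"
    unfolding Q_def
    by (intro continuous_intros continuous_on_snd_compose cX ch X' h' N invU) auto
  have "((\<lambda>s. integral (cbox 0 1) (f s)) has_field_derivative integral (cbox 0 1) (fs 0)) (at 0 within U)"
  proof (rule leibniz_rule_field_derivative)
    show "((\<lambda>s. f s t) has_real_derivative fs s t) (at s within U)"
      if "s \<in> U" "t \<in> cbox 0 1" for s t
      unfolding f_def fs_def Q_def
      by (rule has_derivative_squared_norm [OF N]) (use that invU in auto)
    show "f s integrable_on cbox 0 1" if "s \<in> U" for s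
      unfolding f_def Q_def
      by (intro integrable_continuous continuous_intros N invU that; simp add: cX ch X' h')
    show "continuous_on (U \<times> cbox 0 1) (\<lambda>(s, t). fs s t)"
      unfolding fs_def case_prod_beta cbox_interval
      by (intro continuous_intros continuous_on_snd_compose cX ch X' h' N invU c2) auto
    show "0 \<in> U" "convex U" using e by (auto simp: U_def)
  qed
  then have "((\<lambda>s. action (g_metric N) (\<lambda>t. X t + s *\<^sub>R h t)) has_field_derivative
      integral (cbox 0 1) (fs 0)) (at 0 within U)"
    by (rule has_field_derivative_transform_within [where d = 1]) (use e act in \<open>auto simp: U_def\<close>)
  moreover have "at 0 within U = at (0::real)"
    unfolding U_def using e by (intro at_within_Icc_at) auto
  moreover have "integral (cbox 0 1) (fs 0)
      = integral {0..1} (\<lambda>t. 2 * (h' t \<bullet> P t - h t \<bullet> half_grad N (X t) (P t)))"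
    unfolding cbox_interval
  proof (rule Henstock_Kurzweil_Integration.integral_cong)
    fix t :: real assume t: "t \<in> {0..1}"
    have "Q 0 t = P t"
      using A_op_A_inv(2) [OF N inv [OF t], of "P t"] P [OF t] by (simp add: Q_def)
    then show "fs 0 t = 2 * (h' t \<bullet> P t - h t \<bullet> half_grad N (X t) (P t))"
      by (simp add: fs_def inner_A_deriv [OF inv [OF t]])
  qed
  ultimately show ?thesis by (simp only: integral_mult_right)
qed

text \<open>With a primitive \<open>\<Gamma>\<close> of \<open>G\<close>, integration by parts turns
  the hypothesis into orthogonality of \<open>P + \<Gamma>\<close> to every admissible
  \<open>h'\<close>. Testing with \<open>h' = P + \<Gamma> - c\<close> forces
  \<open>P = c - \<Gamma>\<close>, so differentiability of the merely continuous \<open>P\<close> is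
  a conclusion.\<close>

lemma du_Bois_Reymond:
  fixes P G :: "real \<Rightarrow> 'a::euclidean_space"
  assumes P: "continuous_on {0..1} P" and G: "continuous_on {0..1} G"
    and crit: "\<And>h h'. \<lbrakk>continuous_on {0..1} h';
        \<And>t. t \<in> {0..1} \<Longrightarrow> (h has_vector_derivative h' t) (at t within {0..1}); h 0 = 0; h 1 = 0\<rbrakk>
      \<Longrightarrow> integral {0..1} (\<lambda>t. h' t \<bullet> P t - h t \<bullet> G t) = 0"
    and t: "t \<in> {0..1}"
  shows "(P has_vector_derivative - G t) (at t within {0..1})"
proof -
  define \<Gamma> where "\<Gamma> t = integral {0..t} G" for t
  have d\<Gamma>: "(\<Gamma> has_vector_derivative G t) (at t within {0..1})" if "t \<in> {0..1}" for t
    unfolding \<Gamma>_def by (rule integral_has_vector_derivative [OF G that])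
  have c\<Gamma>: "continuous_on {0..1} \<Gamma>"
    using d\<Gamma> by (meson continuous_on_vector_derivative)
  \<comment> \<open>The mean value of \<open>P + \<Gamma>\<close>; subtracting it makes
    \<open>h 1 = 0\<close>.\<close>
  define c where "c = integral {0..1} (\<lambda>t. P t + \<Gamma> t)"
  define h' where "h' t = P t + \<Gamma> t - c" for t
  define h where "h t = integral {0..t} h'" for t
  have ch': "continuous_on {0..1} h'"
    unfolding h'_def by (intro continuous_intros P c\<Gamma>)
  have dh: "(h has_vector_derivative h' t) (at t within {0..1})" if "t \<in> {0..1}" for t
    unfolding h_def by (rule integral_has_vector_derivative [OF ch' that])
  have ch: "continuous_on {0..1} h"
    using dh by (meson continuous_on_vector_derivative)
  have h0: "h 0 = 0" by (simp add: h_def)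
  have "((\<lambda>t. P t + \<Gamma> t) has_integral c) {0..1}"
    unfolding c_def by (intro integrable_integral integrable_continuous_interval continuous_intros P c\<Gamma>)
  then have "(h' has_integral c - c) {0..1}"
    unfolding h'_def by (rule has_integral_diff) (use has_integral_const_real [of c 0 1] in simp)
  then have hI: "(h' has_integral 0) {0..1}" by simp
  then have h1: "h 1 = 0" by (simp add: h_def integral_unique)
  have "((\<lambda>t. h' t \<bullet> \<Gamma> t + h t \<bullet> G t) has_integral h 1 \<bullet> \<Gamma> 1 - h 0 \<bullet> \<Gamma> 0) {0..1}"
  proof (rule fundamental_theorem_of_calculus)
    show "((\<lambda>t. h t \<bullet> \<Gamma> t) has_vector_derivative h' t \<bullet> \<Gamma> t + h t \<bullet> G t) (at t within {0..1})"
      if "t \<in> {0..1}" for t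
      using bounded_bilinear.has_vector_derivative [OF bounded_bilinear_inner dh [OF that] d\<Gamma> [OF that]]
      by (simp add: add.commute)
  qed simp
  then have I1: "((\<lambda>t. h' t \<bullet> \<Gamma> t + h t \<bullet> G t) has_integral 0) {0..1}"
    by (simp add: h0 h1)
  have I2: "((\<lambda>t. h' t \<bullet> P t - h t \<bullet> G t) has_integral 0) {0..1}"
  proof -
    have "integral {0..1} (\<lambda>t. h' t \<bullet> P t - h t \<bullet> G t) = 0"
      by (rule crit [OF ch' _ h0 h1]) (rule dh)
    moreover have "(\<lambda>t. h' t \<bullet> P t - h t \<bullet> G t) integrable_on {0..1}"
      by (intro integrable_continuous_interval continuous_intros ch' ch P G)
    ultimately show ?thesis
      using integrable_integral by metis
  qed
  have I3: "((\<lambda>t. h' t \<bullet> c) has_integral 0) {0..1}"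
    using has_integral_linear [OF hI bounded_linear_inner_left [of c]] by (simp add: o_def)
  \<comment> \<open>Expand the second factor as \<open>P t + \<Gamma> t - c\<close>; the terms with
    \<open>h t \<bullet> G t\<close> cancel between \<open>I2\<close> and \<open>I1\<close>.\<close>
  have "((\<lambda>t. h' t \<bullet> h' t) has_integral 0 + 0 - 0) {0..1}"
    by (rule has_integral_eq [OF _ has_integral_diff [OF has_integral_add [OF I2 I1] I3]])
      (simp add: h'_def inner_add_right inner_diff_right inner_add_left inner_diff_left)
  then have "integral {0..1} (\<lambda>t. h' t \<bullet> h' t) = 0" by (simp add: integral_unique)
  then have "h' t = 0" if "t \<in> {0..1}" for t
    using integral_eq_0_iff [of 0 1 "\<lambda>t. h' t \<bullet> h' t"] that
    by (simp add: continuous_on_inner ch')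
  then have eq: "c - \<Gamma> t = P t" if "t \<in> {0..1}" for t
    using that by (simp add: h'_def algebra_simps)
  have "((\<lambda>t. c - \<Gamma> t) has_vector_derivative - G t) (at t within {0..1})"
    using d\<Gamma> [OF t] by (auto intro!: derivative_eq_intros)
  then show ?thesis
    by (rule has_vector_derivative_transform [OF t, rotated]) (simp add: eq)
qed

section \<open>Geodesics and the boundary value problem\<close>

theorem theorem2p1:
  fixes N :: nat and A B :: "real^'d^'d"
    and X U S V :: "real \<Rightarrow> real^'d^'d"
  assumes "N \<ge> 1" and "invertible A" and "invertible B"
    and "path X" and "\<forall>t\<in>{0..1}. invertible (X t)"
    and "\<forall>t\<in>{0..1}. is_svd (X t) (U t) (S t) (V t)"
  shows "geodesic_between {Y. invertible Y} (g_metric N) A B X \<longleftrightarrow>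
    (\<exists>P :: real \<Rightarrow> real^'d^'d. path P \<and>
       (\<forall>t\<in>{0..1}.
          (X has_vector_derivative A_op N (X t) (P t)) (at t within {0..1}) \<and>
          (P has_vector_derivative
             - (U t ** (\<Sum>p = 1..N.
                  hadamard (f1 ((real N - real p) / real N) (S t ** S t))
                           (M1 N p (U t) (S t) (V t) (P t)) ** S t
                + S t ** hadamard (f1 ((real p - 1) / real N) (S t ** S t))
                           (M2 N p (U t) (S t) (V t) (P t)))
              ** transpose (V t))) (at t within {0..1})) \<and>
       X 0 = A \<and> X 1 = B)"
    (is "?lhs \<longleftrightarrow> ?rhs")
proof -
  note N = assms(1)
  have inv: "\<And>t. t \<in> {0..1} \<Longrightarrow> invertible (X t)" using assms(5) by blast
  have cX: "continuous_on {0..1} X" using assms(4) by (simp add: path_def)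
  let ?system = "\<lambda>P. path P \<and> (\<forall>t\<in>{0..1}. (X has_vector_derivative A_op N (X t) (P t)) (at t within {0..1})
      \<and> (P has_vector_derivative - half_grad N (X t) (P t)) (at t within {0..1})) \<and> X 0 = A \<and> X 1 = B"
  \<comment> \<open>The singular value decompositions disappear here: the rewritten system depends
    on \<open>X\<close> and \<open>P\<close> alone.\<close>
  have rhs: "?rhs \<longleftrightarrow> (\<exists>P. ?system P)"
    by (intro ex_cong1 conj_cong ball_cong refl) (simp only: half_grad_svd [OF assms(6) [rule_format]])
  show ?thesis
    unfolding rhs
  proof
    assume geo: ?lhs
    then obtain X' where X': "continuous_on {0..1} X'"
      and dX: "\<And>t. t \<in> {0..1} \<Longrightarrow> (X has_vector_derivative X' t) (at t within {0..1})"
      unfolding geodesic_between_def C1_path_def by blast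
    \<comment> \<open>The choice forced by the first equation of the system.\<close>
    define P where "P t = A_inv N (X t) (X' t)" for t
    have AP: "A_op N (X t) (P t) = X' t" if "t \<in> {0..1}" for t
      unfolding P_def by (rule A_op_A_inv [OF N inv [OF that]])
    have cP: "continuous_on {0..1} P"
      unfolding P_def by (intro continuous_intros N cX X' inv)
    have "(P has_vector_derivative - half_grad N (X t) (P t)) (at t within {0..1})" if "t \<in> {0..1}" for t
    proof (rule du_Bois_Reymond [OF cP _ _ that])
      show "continuous_on {0..1} (\<lambda>t. half_grad N (X t) (P t))"
        by (intro continuous_intros cX cP inv)
      fix h h' :: "real \<Rightarrow> real^'d^'d"
      assume h: "continuous_on {0..1} h'"
        "\<And>t. t \<in> {0..1} \<Longrightarrow> (h has_vector_derivative h' t) (at t within {0..1})" "h 0 = 0" "h 1 = 0"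
      then have "((\<lambda>s. action (g_metric N) (\<lambda>t. X t + s *\<^sub>R h t)) has_real_derivative 0) (at 0)"
        using geo unfolding geodesic_between_def C1_path_def by blast
      from DERIV_unique [OF first_variation [OF N X' h(1) dX h(2) inv AP] this]
      show "integral {0..1} (\<lambda>t. h' t \<bullet> P t - h t \<bullet> half_grad N (X t) (P t)) = 0" by simp
    qed
    with geo cP dX AP show "\<exists>P. ?system P"
      unfolding geodesic_between_def path_def by metis
  next
    assume "\<exists>P. ?system P"
    then obtain P where "path P" and ends: "X 0 = A" "X 1 = B"
      and dX: "\<And>t. t \<in> {0..1} \<Longrightarrow> (X has_vector_derivative A_op N (X t) (P t)) (at t within {0..1})"
      and dP: "\<And>t. t \<in> {0..1} \<Longrightarrow> (P has_vector_derivative - half_grad N (X t) (P t)) (at t within {0..1})"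
      by blast
    then have cP: "continuous_on {0..1} P" by (simp add: path_def)
    have X': "continuous_on {0..1} (\<lambda>t. A_op N (X t) (P t))"
      by (intro continuous_intros cX cP inv)
    have "((\<lambda>s. action (g_metric N) (\<lambda>t. X t + s *\<^sub>R h t)) has_real_derivative 0) (at 0)"
      if "C1_path h" and ends: "h 0 = 0" "h 1 = 0" for h
    proof -
      obtain h' where h': "continuous_on {0..1} h'"
        and dh: "\<And>t. t \<in> {0..1} \<Longrightarrow> (h has_vector_derivative h' t) (at t within {0..1})"
        using \<open>C1_path h\<close> unfolding C1_path_def by blast
      \<comment> \<open>By the second equation the integrand is the derivative of
        \<open>h t \<bullet> P t\<close>, so only boundary terms remain, and these vanish.\<close>
      have "((\<lambda>t. h' t \<bullet> P t - h t \<bullet> half_grad N (X t) (P t)) has_integral h 1 \<bullet> P 1 - h 0 \<bullet> P 0) {0..1}"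
      proof (rule fundamental_theorem_of_calculus)
        show "((\<lambda>t. h t \<bullet> P t) has_vector_derivative h' t \<bullet> P t - h t \<bullet> half_grad N (X t) (P t))
            (at t within {0..1})" if "t \<in> {0..1}" for t
          using bounded_bilinear.has_vector_derivative [OF bounded_bilinear_inner dh [OF that] dP [OF that]]
          by simp
      qed simp
      then have "integral {0..1} (\<lambda>t. h' t \<bullet> P t - h t \<bullet> half_grad N (X t) (P t)) = 0"
        by (simp add: ends integral_unique)
      with first_variation [OF N X' h' dX dh inv refl] show ?thesis by simp
    qed
    with X' dX inv ends show ?lhs
      unfolding geodesic_between_def C1_path_def by blast
  qed
qed

end
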